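(* Let $\tau\in\{321,132,213\}$. For every integer $n\geq 0$, $$\sum_{\sigma\in S_n(\tau)}q^{\mathrm{cr}(\sigma)}=C_n(1,q).$$ Moreover, as formal power series in $z$, $$\sum_{\sigma\in S(\tau)} q^{\mathrm{cr}(\sigma)}z^{|\sigma|}=\cfrac{1}{1-\cfrac{z}{1-\cfrac{z}{1-\cfrac{qz}{1-\cfrac{qz}{1-\cfrac{q^2z}{1-\cfrac{q^2z}{\ddots}}}}}}},$$ where the successive partial numerators after the leading $1$ are $z,z,qz,qz,q^2z,q^2z,q^3z,q^3z,\ldots$
   Context: $S_n$ is the set of permutations of $[n]=\{1,\ldots,n\}$ (with $S_0$ consisting of the empty permutation, which has no crossing), and $|\sigma|$ is the length of $\sigma$. For a pattern $\tau\in S_m$, $S_n(\tau)$ is the set of $\sigma\in S_n$ avoiding $\tau$, i.e. having no subsequence $\sigma(i_1)\cdots\sigma(i_m)$ with $i_1<\cdots<i_m$ in the same relative order as $\tau$; $S(\tau)=\bigcup_{n\geq 0}S_n(\tau)$. A crossing of $\sigma$ is a pair $(i,j)$ with $i<j<\sigma(i)<\sigma(j)$ or $\sigma(i)<\sigma(j)\leq i<j$; $\mathrm{cr}(\sigma)$ is the number of crossings. The polynomials $C_n(q,p)$ (a $q,p$-analogue of the Catalan numbers) are defined by $C_0(q,p)=C_1(q,p)=1$ and, for $n\geq 2$, $$C_n(q,p)=C_{n-1}(q,p)+q\sum_{k=0}^{n-2}p^kC_k(q,p)C_{n-1-k}(q,p).$$ $C_n(1,q)$ denotes the result of substituting $1$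 for the first variable and $q$ for the second. *)

theory Defs
  imports
    "HOL-Analysis.Infinite_Sum"
    "HOL-Combinatorics.Multiset_Permutations"
    "HOL-Computational_Algebra.Polynomial"
    "HOL-Computational_Algebra.Formal_Power_Series"
begin

(* A permutation of {1..n} is its one-line notation, a list of length n;
   perm_app is 1-based, so that perm_app s i is the image of i under s. *)

definition perm_app :: "nat list \<Rightarrow> nat \<Rightarrow> nat" where
  "perm_app \<sigma> i = \<sigma> ! (i - 1)"

definition contains_pattern :: "nat list \<Rightarrow> nat list \<Rightarrow> bool" where
  "contains_pattern \<sigma> \<tau> \<longleftrightarrow>
     (\<exists>\<iota>. strict_mono_on {1..length \<tau>} \<iota> \<and> \<iota> ` {1..length \<tau>} \<subseteq> {1..length \<sigma>} \<and>
          (\<forall>a\<in>{1..length \<tau>}. \<forall>b\<in>{1..length \<tau>}.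
             perm_app \<sigma> (\<iota> a) < perm_app \<sigma> (\<iota> b) \<longleftrightarrow> perm_app \<tau> a < perm_app \<tau> b))"

definition avoiders_of_size :: "nat \<Rightarrow> nat list \<Rightarrow> nat list set" where
  "avoiders_of_size n \<tau> = {\<sigma> \<in> permutations_of_set {1..n}. \<not> contains_pattern \<sigma> \<tau>}"

definition avoiders :: "nat list \<Rightarrow> nat list set" where
  "avoiders \<tau> = (\<Union>n. avoiders_of_size n \<tau>)"

definition cr :: "nat list \<Rightarrow> nat" where
  "cr \<sigma> = card {(i, j). i \<in> {1..length \<sigma>} \<and> j \<in> {1..length \<sigma>} \<and>
     (i < j \<and> j < perm_app \<sigma> i \<and> perm_app \<sigma> i < perm_app \<sigma> j \<or>
      perm_app \<sigma> i < perm_app \<sigma> j \<and> perm_app \<sigma> j \<le> i \<and> i < j)}"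

(* Z[q,p] is rendered as int poly poly: q is the outer variable and p the variable of the
   coefficients.  Hence poly (qp_catalan n) 1 is C_n(1,p), a polynomial in the remaining
   variable. *)

definition var_q :: "int poly poly" where
  "var_q = [:0, 1:]"

definition var_p :: "int poly poly" where
  "var_p = [:[:0, 1:]:]"

fun qp_catalan :: "nat \<Rightarrow> int poly poly" where
  "qp_catalan 0 = 1"
| "qp_catalan (Suc 0) = 1"
| "qp_catalan (Suc (Suc m)) = qp_catalan (Suc m) +
     var_q * (\<Sum>k = 0..m. var_p ^ k * qp_catalan k * qp_catalan (Suc m - k))"

(* The N-th convergent of 1/(1 - c_0 z/(1 - c_1 z/(1 - ...))).  Over a ring that is not a field
   there is no inverse on fps; fps_right_inverse f 1 is the reciprocal of a series f with
   constant term 1 (see cfrac_convergent_Suc_mult). *)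

primrec cfrac_convergent :: "nat \<Rightarrow> (nat \<Rightarrow> 'a::comm_ring_1) \<Rightarrow> 'a fps" where
  "cfrac_convergent 0 c = 1"
| "cfrac_convergent (Suc N) c =
     fps_right_inverse
       (1 - fps_const (c 0) * fps_X * cfrac_convergent N (\<lambda>j. c (Suc j))) 1"

lemma cfrac_convergent_Suc_mult:
  "(1 - fps_const (c 0) * fps_X * cfrac_convergent N (\<lambda>j. c (Suc j))) *
     cfrac_convergent (Suc N) c = 1"
  unfolding cfrac_convergent.simps by (rule fps_right_inverse) (simp add: mult.assoc)

end

(* Let N(t, h) be the weighted number of lattice paths with t steps from height 0 to height h that
   stay nonnegative, where a step up from height j has weight q^(j div 2). All three sums turn out
   to be N(2n, 0), and these numbers are the coefficients of the continued fraction.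

   For 321, the sum of q^cr over the avoiders of size m whose last i values are all at most m - j
   is N(2m - i - j, i + j) if j = i or j = i - 1: the last step is up if sigma(m - i) = m,
   respectively sigma(m) = m - j, in which case this point is deleted, and down otherwise.

   For 132, count crossings with respect to a diagonal shifted by s. For the avoiders of size m with
   sigma(1) <= m + 1 - a, sigma^(-1)(1) <= m + 1 - b and (if a, b >= 1) sigma(m) < m, taking
   s = ceil((a - b) / 2), the sum is q^(s(s-1)/2) N(2m - a - b, a + b); the recurrence comes from
   deleting the first column, the bottom row or the point (m, m). The pattern 213 reduces to 132 by
   the reverse-complement-inverse. *)

theory Submission
  imports Defs
begin

unbundle fps_syntax

section \<open>Weighted lattice paths and continued fractions\<close>

text \<open>Crossings are not stable under the natural deletions: removing (1, v) moves the points
  below row v by one relative to the diagonal but not those above it, and inversion trades the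
  strict inequality in one kind of crossing for the weak one in the other. For 132 the shift s
  absorbs both effects: deleting the first column takes s to s - 1, and inversion takes s to 1 - s.
  The parity of a - b decides which deletion fits (column if odd, row if even), and (m, m) is
  deleted when the parameter to be lowered is already 0. The exponent s(s-1)/2 is invariant under s
  -> 1 - s, and its increments make up the difference between the crossings gained and (a + b - 1)
  div 2. For a, b >= 1 the exclusion of (m, m) forces the largest value to the left of the value 1;
  this keeps the top rows on one side of the shifted diagonal, so that each of them gains exactly
  one crossing.\<close>

fun path_weight :: "(nat \<Rightarrow> 'a::comm_ring_1) \<Rightarrow> nat \<Rightarrow> nat \<Rightarrow> 'a" where
  "path_weight c 0 h = (if h = 0 then 1 else 0)"
| "path_weight c (Suc t) 0 = path_weight c t 1"
| "path_weight c (Suc t) (Suc h) = c h * path_weight c t h + path_weight c t (Suc (Suc h))"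

lemma path_weight_eq_0: "t < h \<Longrightarrow> path_weight c t h = 0"
  by (induction c t h rule: path_weight.induct) auto

text \<open>\<open>F h\<close> counts excursions above height \<open>h\<close>, with z marking down
  steps. Cutting a path from 0 to \<open>h\<close> at its last visits to the heights below
  \<open>h\<close> gives alternately excursions and up steps, whence the product
  \<open>P h\<close>.\<close>

lemma path_weight_continued_fraction:
  fixes F :: "nat \<Rightarrow> 'a::comm_ring_1 fps"
  assumes F: "\<And>h. F h = 1 + fps_const (c h) * fps_X * F h * F (Suc h)"
  shows "path_weight c (2 * n) 0 = F 0 $ n"
proof -
  define P where "P h = fps_const (\<Prod>i<h. c i) * (\<Prod>i\<le>h. F i)" for h
  have P_0: "P 0 = 1 + fps_X * P 1"
    using F[of 0] by (simp add: P_def algebra_simps)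
  have P_Suc: "P (Suc h) = fps_const (c h) * P h + fps_X * P (Suc (Suc h))" for h
  proof -
    have "P (Suc h) = fps_const (\<Prod>i<Suc h. c i) * (\<Prod>i\<le>h. F i) * F (Suc h)"
      by (simp add: P_def mult.assoc)
    also have "\<dots> = fps_const (\<Prod>i<Suc h. c i) * (\<Prod>i\<le>h. F i) *
        (1 + fps_const (c (Suc h)) * fps_X * F (Suc h) * F (Suc (Suc h)))"
      by (subst F) rule
    also have "\<dots> = fps_const (c h) * P h + fps_X * P (Suc (Suc h))"
      by (simp add: P_def algebra_simps flip: fps_const_mult)
    finally show ?thesis .
  qed
  \<comment> \<open>\<open>n\<close> is the number of down steps of a path with \<open>t\<close>
    steps ending at \<open>h\<close>; only these contribute a factor \<open>fps_X\<close>.\<close>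
  have "path_weight c t h = P h $ n" if "t = 2 * n + h" for t h n
    using that
  proof (induction t arbitrary: n h)
    case 0
    then show ?case by (simp add: P_0)
  next
    case (Suc t)
    show ?case
    proof (cases h)
      case 0
      with Suc.prems obtain k where k: "n = Suc k" by (cases n) auto
      have "path_weight c t 1 = P 1 $ k"
        using Suc.prems 0 k by (intro Suc.IH) simp
      then have "path_weight c (Suc t) 0 = P 0 $ n"
        unfolding path_weight.simps(2) by (simp add: P_0 k)
      with 0 show ?thesis by simp
    next
      case h: (Suc h')
      have "path_weight c t h' = P h' $ n"
        using Suc.prems h by (intro Suc.IH) simp
      moreover have "path_weight c t (Suc h) = (fps_X * P (Suc h)) $ n"
      proof (cases n)
        case 0
        with Suc.prems show ?thesis by (simp add: path_weight_eq_0)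
      next
        case (Suc k)
        with Suc.prems have "path_weight c t (Suc h) = P (Suc h) $ k"
          by (intro Suc.IH) simp
        with Suc show ?thesis by simp
      qed
      moreover have "P h $ n = c h' * P h' $ n + (fps_X * P (Suc h)) $ n"
        unfolding h P_Suc[of h'] by (simp only: fps_add_nth fps_mult_left_const_nth)
      ultimately show ?thesis by (simp only: h path_weight.simps(3))
    qed
  qed
  from this[of "2 * n" n 0] show ?thesis by (simp add: P_def)
qed

text \<open>The difference of two reciprocals contains the difference of the denominators, so
  truncating one level deeper multiplies the error by \<open>fps_X\<close>. The induction treats all
  tails at once because it passes from \<open>h\<close> to \<open>Suc h\<close>.\<close>

lemma cfrac_convergent_tendsto:
  fixes F :: "nat \<Rightarrow> 'a::comm_ring_1 fps"
  assumes F: "\<And>h. F h = 1 + fps_const (c h) * fps_X * F h * F (Suc h)"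
  shows "(\<lambda>N. cfrac_convergent N c) \<longlonglongrightarrow> F 0"
proof -
  have "fps_X ^ Suc N dvd F h - cfrac_convergent N (\<lambda>j. c (h + j))" for N h
  proof (induction N arbitrary: h)
    case 0
    have "F h - 1 = fps_X * (fps_const (c h) * F h * F (Suc h))"
      by (subst (1) F) (simp add: mult_ac)
    then show ?case by simp
  next
    case (Suc N)
    define K where "K = cfrac_convergent (Suc N) (\<lambda>j. c (h + j))"
    define K' where "K' = cfrac_convergent N (\<lambda>j. c (Suc h + j))"
    have K: "K = 1 + fps_const (c h) * fps_X * K' * K"
      using cfrac_convergent_Suc_mult[of "\<lambda>j. c (h + j)" N]
      by (simp add: K_def K'_def algebra_simps del: cfrac_convergent.simps)
    have "(1 - fps_const (c h) * fps_X * F (Suc h)) * F h = 1"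
      using F[of h] by (simp add: algebra_simps)
    moreover have "(1 - fps_const (c h) * fps_X * K') * K = 1"
      using K by (simp add: algebra_simps)
    \<comment> \<open>The products of \<open>K\<close> and of \<open>F h\<close> with their
      denominators equal 1; inserting them leaves only the difference of the denominators.\<close>
    ultimately have "F h - K = F h * ((1 - fps_const (c h) * fps_X * K') * K)
        - (1 - fps_const (c h) * fps_X * F (Suc h)) * F h * K"
      by simp
    also have "\<dots> = fps_X * (F (Suc h) - K') * (fps_const (c h) * F h * K)"
      by (simp add: algebra_simps)
    finally have "F h - K = fps_X * (F (Suc h) - K') * (fps_const (c h) * F h * K)" .
    moreover have "fps_X ^ Suc (Suc N) dvd fps_X * (F (Suc h) - K')"
      using Suc.IH[of "Suc h"] unfolding K'_def power_Suc[of fps_X "Suc N"]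
      by (intro mult_dvd_mono dvd_refl)
    ultimately show ?case unfolding K_def by simp
  qed
  then have dvd: "fps_X ^ Suc N dvd F 0 - cfrac_convergent N c" for N
    by (metis (no_types, lifting) add_0 ext)
  show ?thesis
  proof (rule tendsto_fpsI)
    fix n
    have "cfrac_convergent N c $ n = F 0 $ n" if "N \<ge> n" for N
    proof -
      obtain G where "F 0 - cfrac_convergent N c = fps_X ^ Suc N * G"
        using dvd[of N] by blast
      then have "(F 0 - cfrac_convergent N c) $ n = (fps_X ^ Suc N * G) $ n" by simp
      also have "\<dots> = 0" using that by (simp only: fps_X_power_mult_nth) simp
      finally show ?thesis by simp
    qed
    then show "\<forall>\<^sub>F N in sequentially. cfrac_convergent N c $ n = F 0 $ n"
      by (auto simp: eventually_sequentially)
  qed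
qed

section \<open>The continued fraction of the q-Catalan generating function\<close>

abbreviation q_catalan :: "nat \<Rightarrow> int poly" where
  "q_catalan n \<equiv> poly (qp_catalan n) 1"

lemma q_catalan_Suc_Suc:
  "q_catalan (Suc (Suc m)) =
     q_catalan (Suc m) + (\<Sum>k=0..m. [:0, 1:] ^ k * q_catalan k * q_catalan (Suc m - k))"
  by (simp add: var_q_def var_p_def poly_sum)

text \<open>The recurrence says \<open>C(z) = 1 + z C(z) + z C(qz) (C(z) - 1)\<close>, that is,
  \<open>C(z) = 1 + z C(z) D(z)\<close> with \<open>D(z) = 1 / (1 - z C(qz))\<close>; the tails of the continued fraction are
  \<open>C(q\<^sup>jz)\<close> and \<open>D(q\<^sup>jz)\<close>.\<close>

lemma ex_q_catalan_continued_fraction_tails: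
  "\<exists>F. (\<forall>h. F h = 1 + fps_const ([:0, 1:] ^ (h div 2)) * fps_X * F h * F (Suc h)) \<and>
    F 0 = Abs_fps q_catalan"
proof -
  define q :: "int poly" where "q = [:0, 1:]"
  \<comment> \<open>\<open>S j\<close> substitutes \<open>q^j z\<close> for z; being a ring
    endomorphism, it carries the equations for \<open>C\<close> and \<open>D\<close> to every
    tail.\<close>
  define S where "S j f = Abs_fps (\<lambda>n. q ^ (j * n) * f $ n)" for j and f :: "int poly fps"
  have S_0: "S 0 f = f" for f by (simp add: S_def fps_eq_iff)
  have S_S: "S j (S 1 f) = S (Suc j) f" for j f
    by (simp add: S_def fps_eq_iff power_add mult_ac)
  have S_add: "S j (f + g) = S j f + S j g" for j f g
    by (simp add: S_def fps_eq_iff algebra_simps)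
  have S_1: "S j 1 = 1" for j
    by (simp add: S_def fps_eq_iff)
  have S_X: "S j fps_X = fps_const (q ^ j) * fps_X" for j
    by (auto simp: S_def fps_eq_iff fps_X_def)
  have S_mult: "S j (f * g) = S j f * S j g" for j f g
  proof (rule fps_ext)
    fix n
    have "q ^ (j * n) = q ^ (j * i) * q ^ (j * (n - i))" if "i \<le> n" for i
      using that by (simp flip: power_add distrib_left)
    then show "S j (f * g) $ n = (S j f * S j g) $ n"
      by (simp add: S_def fps_mult_nth sum_distrib_left mult_ac)
  qed
  define C where "C = Abs_fps q_catalan"
  have C: "C = 1 + fps_X * C + fps_X * S 1 C * (C - 1)"
  proof (rule fps_ext)
    fix n
    show "C $ n = (1 + fps_X * C + fps_X * S 1 C * (C - 1)) $ n"
    proof (cases n)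
      case 0
      then show ?thesis by (simp add: C_def)
    next
      case n: (Suc n')
      show ?thesis
      proof (cases n')
        case 0
        with n show ?thesis by (simp add: C_def mult.assoc)
      next
        case (Suc m)
        have "(S 1 C * (C - 1)) $ Suc m = (\<Sum>k=0..Suc m. q ^ k * q_catalan k * (C - 1) $ (Suc m - k))"
          by (simp add: fps_mult_nth S_def C_def)
        \<comment> \<open>The term \<open>k = Suc m\<close> disappears because \<open>C - 1\<close>
          has constant term 0; this is why the recurrence stops at \<open>m\<close>.\<close>
        also have "\<dots> = (\<Sum>k=0..m. q ^ k * q_catalan k * q_catalan (Suc m - k))"
          by (simp add: C_def)
        finally show ?thesis
          using n Suc q_catalan_Suc_Suc[of m] by (simp add: C_def q_def mult.assoc)
      qed
    qed
  qed
  define D where "D = fps_right_inverse (1 - fps_X * S 1 C) 1"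
  have D: "(1 - fps_X * S 1 C) * D = 1"
    unfolding D_def by (rule fps_right_inverse) simp
  have "C * (1 - fps_X * S 1 C) = 1 - fps_X * S 1 C + fps_X * C"
    using C by (simp add: algebra_simps)
  then have "C * ((1 - fps_X * S 1 C) * D) = (1 - fps_X * S 1 C) * D + fps_X * C * D"
    by (metis (no_types, lifting) distrib_right mult.assoc)
  then have CD: "C = 1 + fps_X * C * D" using D by simp
  have DC: "D = 1 + fps_X * D * S 1 C" using D by (simp add: algebra_simps)
  define F where "F h = S (h div 2) (if even h then C else D)" for h
  show ?thesis
  proof (intro exI[of _ F] conjI allI)
    show "F 0 = Abs_fps q_catalan" by (simp add: F_def S_0 C_def)
    fix h
    show "F h = 1 + fps_const ([:0, 1:] ^ (h div 2)) * fps_X * F h * F (Suc h)"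
    proof (cases "even h")
      case True
      have "S j C = 1 + fps_const (q ^ j) * fps_X * S j C * S j D" for j
        using arg_cong[OF CD, of "S j"] unfolding S_add S_mult S_1 S_X by (simp only: mult.assoc)
      from this[of "h div 2"] True show ?thesis
        by (simp only: F_def q_def even_Suc_div_two even_Suc if_True if_False simp_thms)
    next
      case False
      have "S j D = 1 + fps_const (q ^ j) * fps_X * S j D * S (Suc j) C" for j
        using arg_cong[OF DC, of "S j"] unfolding S_add S_mult S_1 S_X S_S by (simp only: mult.assoc)
      from this[of "h div 2"] False show ?thesis
        by (simp only: F_def q_def odd_Suc_div_two even_Suc if_True if_False simp_thms)
    qed
  qed
qed

section \<open>Permutations as sets of points\<close>

text \<open>Integer coordinates keep expressions such as \<open>m - h\<close> and negative shifts
  free of truncation, and sets of points can be transposed, reflected and inflated by taking images.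
  For \<open>m <= 0\<close> only the empty graph remains.\<close>

definition perm_graphs :: "int \<Rightarrow> (int \<times> int) set set" where
  "perm_graphs m = {G. bij_betw fst G {1..m} \<and> bij_betw snd G {1..m}}"

lemma perm_graphs_bounds:
  assumes "G \<in> perm_graphs m" "(x, y) \<in> G"
  shows "1 \<le> x" "x \<le> m" "1 \<le> y" "y \<le> m"
  using assms by (force simp: perm_graphs_def bij_betw_def)+

lemma perm_graphs_unique_snd:
  "G \<in> perm_graphs m \<Longrightarrow> (x, y) \<in> G \<Longrightarrow> (x, y') \<in> G \<Longrightarrow> y = y'"
  by (auto simp: perm_graphs_def bij_betw_def dest: inj_onD[of fst G "(x, y)" "(x, y')"])

lemma perm_graphs_unique_fst:
  "G \<in> perm_graphs m \<Longrightarrow> (x, y) \<in> G \<Longrightarrow> (x', y) \<in> G \<Longrightarrow> x = x'"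
  by (auto simp: perm_graphs_def bij_betw_def dest: inj_onD[of snd G "(x, y)" "(x', y)"])

lemma perm_graphs_ex_snd:
  assumes "G \<in> perm_graphs m" "1 \<le> x" "x \<le> m"
  shows "\<exists>y. (x, y) \<in> G"
proof -
  have "x \<in> fst ` G" using assms by (auto simp: perm_graphs_def bij_betw_def)
  then show ?thesis by auto
qed

lemma perm_graphs_ex_fst:
  assumes "G \<in> perm_graphs m" "1 \<le> y" "y \<le> m"
  shows "\<exists>x. (x, y) \<in> G"
proof -
  have "y \<in> snd ` G" using assms by (auto simp: perm_graphs_def bij_betw_def)
  then show ?thesis by auto
qed

lemma finite_perm_graph: "G \<in> perm_graphs m \<Longrightarrow> finite G"
  by (auto simp: perm_graphs_def dest: bij_betw_finite)

lemma finite_perm_graphs: "finite (perm_graphs m)"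
proof (rule finite_subset)
  show "perm_graphs m \<subseteq> Pow ({1..m} \<times> {1..m})"
    by (auto dest: perm_graphs_bounds)
qed auto

lemma perm_graphs_0: "m \<le> 0 \<Longrightarrow> perm_graphs m = {{}}"
  by (auto simp: perm_graphs_def bij_betw_def)

lemma card_perm_graph_snd:
  assumes "G \<in> perm_graphs m" "A \<subseteq> {1..m}"
  shows "card {p \<in> G. snd p \<in> A} = card A"
proof -
  have "bij_betw snd {p \<in> G. snd p \<in> A} A"
    using assms unfolding perm_graphs_def bij_betw_def by (auto intro: inj_on_subset simp: image_iff)
  then show ?thesis by (rule bij_betw_same_card)
qed

lemma card_perm_graph_fst:
  assumes "G \<in> perm_graphs m" "A \<subseteq> {1..m}"
  shows "card {p \<in> G. fst p \<in> A} = card A"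
proof -
  have "bij_betw fst {p \<in> G. fst p \<in> A} A"
    using assms unfolding perm_graphs_def bij_betw_def by (auto intro: inj_on_subset simp: image_iff)
  then show ?thesis by (rule bij_betw_same_card)
qed

section \<open>Inserting and deleting a point\<close>

definition shift_up :: "int \<Rightarrow> int \<Rightarrow> int" where
  "shift_up k x = (if x < k then x else x + 1)"

lemma shift_up_less [simp]:
  "shift_up k x < shift_up k y \<longleftrightarrow> x < y"
  "shift_up k x < k \<longleftrightarrow> x < k"
  "k < shift_up k x \<longleftrightarrow> k \<le> x"
  by (auto simp: shift_up_def)

lemma shift_up_eq [simp]:
  "shift_up k x = shift_up k y \<longleftrightarrow> x = y"
  "shift_up k x \<noteq> k" "k \<noteq> shift_up k x"
  by (auto simp: shift_up_def)

lemma bij_betw_shift_up: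
  assumes "1 \<le> k" "k \<le> m + 1"
  shows "bij_betw (shift_up k) {1..m} ({1..m + 1} - {k})"
  by (rule bij_betw_byWitness[where f' = "\<lambda>x. if x < k then x else x - 1"])
     (use assms in \<open>auto simp: shift_up_def split: if_splits\<close>)

definition insert_point :: "int \<Rightarrow> int \<Rightarrow> (int \<times> int) set \<Rightarrow> (int \<times> int) set" where
  "insert_point k v G = insert (k, v) (map_prod (shift_up k) (shift_up v) ` G)"

lemma mem_insert_point:
  "(x, y) \<in> insert_point k v G \<longleftrightarrow>
     x = k \<and> y = v \<or> (\<exists>x' y'. (x', y') \<in> G \<and> x = shift_up k x' \<and> y = shift_up v y')"
  by (force simp: insert_point_def)

lemma shift_up_in_insert_point:
  "(x, y) \<in> G \<Longrightarrow> (shift_up k x, shift_up v y) \<in> insert_point k v G"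
  by (auto simp: mem_insert_point)

lemma inj_insert_point: "inj_on (insert_point k v) A"
proof (rule inj_onI)
  fix G G' assume eq: "insert_point k v G = insert_point k v G'"
  have "(x, y) \<in> H \<longleftrightarrow> (shift_up k x, shift_up v y) \<in> insert_point k v H" for x y H
    by (auto simp: mem_insert_point)
  with eq show "G = G'" by auto
qed

lemma insert_point_in_perm_graphs_iff:
  assumes "1 \<le> k" "k \<le> m + 1" "1 \<le> v" "v \<le> m + 1"
  shows "insert_point k v G \<in> perm_graphs (m + 1) \<longleftrightarrow> G \<in> perm_graphs m"
proof -
  let ?u = "map_prod (shift_up k) (shift_up v)"
  have inj: "inj_on ?u G" by (auto simp: inj_on_def)
  have notin: "(k, v) \<notin> ?u ` G" by auto
  have eq: "bij_betw f (insert_point k v G) {1..m + 1} \<longleftrightarrow> bij_betw f G {1..m}"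
    if f: "\<And>p. f (?u p) = shift_up c (f p)" "f (k, v) = c" and c: "1 \<le> c" "c \<le> m + 1" for f c
  proof -
    have "bij_betw f (insert_point k v G) {1..m + 1} \<longleftrightarrow>
        bij_betw f (?u ` G) ({1..m + 1} - {c})"
    proof -
      have "c \<notin> f ` ?u ` G" by (metis (no_types, lifting) f(1) imageE shift_up_eq(3))
      moreover have "insert c ({1..m + 1} - {c}) = {1..m + 1}" using c by auto
      ultimately show ?thesis
        using notin f(2) notIn_Un_bij_betw3[of "(k, v)" "?u ` G" f "{1..m + 1} - {c}"]
        by (simp add: insert_point_def)
    qed
    also have "\<dots> \<longleftrightarrow> bij_betw (f \<circ> ?u) G ({1..m + 1} - {c})"
      by (rule bij_betw_comp_iff[OF inj_on_imp_bij_betw[OF inj]])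
    also have "f \<circ> ?u = shift_up c \<circ> f"
      using f(1) by (auto simp: fun_eq_iff simp del: map_prod_simp)
    also have "bij_betw (shift_up c \<circ> f) G ({1..m + 1} - {c}) \<longleftrightarrow> bij_betw f G {1..m}"
    proof -
      have S: "shift_up c ` {1..m} = {1..m + 1} - {c}" "inj (shift_up c)"
        using bij_betw_shift_up[OF c] by (auto simp: bij_betw_def inj_on_def)
      show ?thesis
        unfolding bij_betw_def image_comp[symmetric] S(1)[symmetric] inj_image_eq_iff[OF S(2)]
        using S(2) by (auto simp: inj_on_def)
    qed
    finally show ?thesis .
  qed
  have "bij_betw fst (insert_point k v G) {1..m + 1} \<longleftrightarrow> bij_betw fst G {1..m}"
    by (rule eq[where c = k]) (use assms in auto)
  moreover have "bij_betw snd (insert_point k v G) {1..m + 1} \<longleftrightarrow> bij_betw snd G {1..m}"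
    by (rule eq[where c = v]) (use assms in auto)
  ultimately show ?thesis by (simp add: perm_graphs_def)
qed

lemma perm_graph_eq_insert_point:
  assumes G: "G \<in> perm_graphs m" and kv: "(k, v) \<in> G"
  obtains G' where "G = insert_point k v G'"
proof
  \<comment> \<open>The preimage under both shifts is the standardization after deleting
    \<open>(k, v)\<close>; nothing is lost, since no other point lies in column \<open>k\<close> or
    row \<open>v\<close>.\<close>
  let ?G' = "{(x, y). (shift_up k x, shift_up v y) \<in> G}"
  have sur: "\<exists>x'. x = shift_up c x'" if "x \<noteq> c" for x c
    using that by (intro exI[of _ "if x < c then x else x - 1"]) (auto simp: shift_up_def)
  show "G = insert_point k v ?G'"
  proof (rule set_eqI, clarify)
    fix x y
    show "(x, y) \<in> G \<longleftrightarrow> (x, y) \<in> insert_point k v ?G'"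
      using kv sur[of x k] sur[of y v] perm_graphs_unique_fst[OF G, of x v k]
        perm_graphs_unique_snd[OF G, of k y v]
      by (cases "x = k"; cases "y = v") (auto simp: mem_insert_point)
  qed
qed

text \<open>Turns each deletion into a bijection with a class one size smaller. The predicate is
  arbitrary, so all conditions on the larger graph can be examined after insertion.\<close>

lemma perm_graphs_with_point:
  assumes "1 \<le> k" "k \<le> m + 1" "1 \<le> v" "v \<le> m + 1"
  shows "{G \<in> perm_graphs (m + 1). (k, v) \<in> G \<and> P G} =
    insert_point k v ` {G \<in> perm_graphs m. P (insert_point k v G)}" (is "?L = ?R")
proof
  show "?L \<subseteq> ?R"
  proof clarify
    fix G assume G: "G \<in> perm_graphs (m + 1)" "(k, v) \<in> G" "P G"
    obtain G' where "G = insert_point k v G'"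
      using perm_graph_eq_insert_point[OF G(1,2)] .
    with G insert_point_in_perm_graphs_iff[OF assms, of G'] show "G \<in> ?R" by simp
  qed
  show "?R \<subseteq> ?L"
    using insert_point_in_perm_graphs_iff[OF assms] by (auto simp: insert_point_def)
qed

text \<open>The crossings of the permutation shifted vertically by \<open>s\<close>.\<close>

fun crosses :: "int \<Rightarrow> int \<times> int \<Rightarrow> int \<times> int \<Rightarrow> bool" where
  "crosses s (x, y) (x', y') \<longleftrightarrow> x < x' \<and> y < y' \<and> (x' < y + s \<or> y' + s \<le> x)"

definition crossings :: "int \<Rightarrow> (int \<times> int) set \<Rightarrow> nat" where
  "crossings s G = card {(p, r). p \<in> G \<and> r \<in> G \<and> crosses s p r}"

text \<open>Grouping crossings by their right-hand point allows the effect of an insertion to be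
  computed for each such point separately.\<close>

lemma crossings_eq_sum:
  assumes "finite G"
  shows "crossings s G = (\<Sum>r\<in>G. card {p \<in> G. crosses s p r})"
proof -
  have "{(p, r). p \<in> G \<and> r \<in> G \<and> crosses s p r} = prod.swap ` (SIGMA r:G. {p \<in> G. crosses s p r})"
    by (auto simp: image_iff simp del: crosses.simps)
  then have "crossings s G = card (SIGMA r:G. {p \<in> G. crosses s p r})"
    unfolding crossings_def by (simp only: card_image[OF inj_on_subset[OF inj_swap subset_UNIV]])
  with assms show ?thesis by simp
qed

lemma crossings_insert_point:
  fixes k v :: int
  assumes G: "finite G"
  defines "u \<equiv> map_prod (shift_up k) (shift_up v)"
  shows "crossings s (insert_point k v G) =
    card {p \<in> G. crosses s (u p) (k, v)} +
    (\<Sum>r\<in>G. of_bool (crosses s (k, v) (u r)) + card {p \<in> G. crosses s (u p) (u r)})"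
proof -
  have inj: "inj_on u A" for A by (auto simp: u_def inj_on_def)
  have notin: "(k, v) \<notin> u ` A" for A by (auto simp: u_def)
  have eq: "insert_point k v G = insert (k, v) (u ` G)"
    by (simp add: insert_point_def u_def)
  have card: "card {p \<in> insert_point k v G. crosses s p r} =
      of_bool (crosses s (k, v) r) + card {p \<in> G. crosses s (u p) r}" for r
  proof -
    have "{p \<in> insert_point k v G. crosses s p r} =
        {p \<in> {(k, v)}. crosses s p r} \<union> u ` {p \<in> G. crosses s (u p) r}"
      unfolding eq by blast
    moreover have "{p \<in> {(k, v)}. crosses s p r} \<inter> u ` {p \<in> G. crosses s (u p) r} = {}"
      using notin by blast
    moreover have "{p \<in> {(k, v)}. crosses s p r} = (if crosses s (k, v) r then {(k, v)} else {})"
      by auto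
    ultimately show ?thesis
      using G by (simp add: card_Un_disjoint card_image[OF inj] del: crosses.simps)
  qed
  have "crossings s (insert_point k v G) =
      (\<Sum>r\<in>insert_point k v G. of_bool (crosses s (k, v) r) + card {p \<in> G. crosses s (u p) r})"
    unfolding card[symmetric] by (rule crossings_eq_sum) (use G in \<open>simp add: eq\<close>)
  also have "\<dots> = card {p \<in> G. crosses s (u p) (k, v)} +
      (\<Sum>r\<in>u ` G. of_bool (crosses s (k, v) r) + card {p \<in> G. crosses s (u p) r})"
    unfolding eq sum.insert[OF finite_imageI[OF G] notin] by simp
  finally show ?thesis by (simp only: sum.reindex[OF inj] o_def)
qed

text \<open>Meant for a new point in the top row or the last column, which cannot be the left-hand
  point of a crossing.\<close>

lemma crossings_insert_point_unaffected:
  fixes k v :: int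
  assumes "finite G"
  defines "u \<equiv> map_prod (shift_up k) (shift_up v)"
  assumes "\<And>p r. p \<in> G \<Longrightarrow> r \<in> G \<Longrightarrow> crosses s (u p) (u r) \<longleftrightarrow> crosses s p r"
    and "\<And>r. r \<in> G \<Longrightarrow> \<not> crosses s (k, v) (u r)"
  shows "crossings s (insert_point k v G) = crossings s G + card {p \<in> G. crosses s (u p) (k, v)}"
proof -
  have "card {p \<in> G. crosses s (u p) (u r)} = card {p \<in> G. crosses s p r}" if "r \<in> G" for r
    using that assms(3) by (intro arg_cong[of _ _ card] Collect_cong) blast
  moreover have "\<not> crosses s (k, v) (u r)" if "r \<in> G" for r
    using that assms(4) by blast
  ultimately have "(\<Sum>r\<in>G. of_bool (crosses s (k, v) (u r)) + card {p \<in> G. crosses s (u p) (u r)}) =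
      (\<Sum>r\<in>G. card {p \<in> G. crosses s p r})"
    by (intro sum.cong) (simp_all del: crosses.simps)
  then show ?thesis
    unfolding crossings_insert_point[OF assms(1)] u_def[symmetric] crossings_eq_sum[OF assms(1)]
    by simp
qed

section \<open>Avoiding 321\<close>

abbreviation level_weight :: "nat \<Rightarrow> int poly" where
  "level_weight h \<equiv> [:0, 1:] ^ (h div 2)"

definition graph_avoids_321 :: "(int \<times> int) set \<Rightarrow> bool" where
  "graph_avoids_321 G \<longleftrightarrow> (\<forall>x\<^sub>1 y\<^sub>1 x\<^sub>2 y\<^sub>2 x\<^sub>3 y\<^sub>3.
     (x\<^sub>1, y\<^sub>1) \<in> G \<longrightarrow> (x\<^sub>2, y\<^sub>2) \<in> G \<longrightarrow> (x\<^sub>3, y\<^sub>3) \<in> G \<longrightarrow>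
     x\<^sub>1 < x\<^sub>2 \<longrightarrow> x\<^sub>2 < x\<^sub>3 \<longrightarrow> y\<^sub>1 > y\<^sub>2 \<longrightarrow> y\<^sub>2 > y\<^sub>3 \<longrightarrow> False)"

lemma graph_avoids_321D:
  assumes "graph_avoids_321 G" "(x\<^sub>1, y\<^sub>1) \<in> G" "(x\<^sub>2, y\<^sub>2) \<in> G" "(x\<^sub>3, y\<^sub>3) \<in> G"
    "x\<^sub>1 < x\<^sub>2" "x\<^sub>2 < x\<^sub>3" "y\<^sub>1 > y\<^sub>2" "y\<^sub>2 > y\<^sub>3"
  shows False
  using assms unfolding graph_avoids_321_def by blast

lemma graph_avoids_321_insert_pointD:
  assumes "graph_avoids_321 (insert_point k v G)"
  shows "graph_avoids_321 G"
  unfolding graph_avoids_321_def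
proof (intro allI impI)
  fix x\<^sub>1 y\<^sub>1 x\<^sub>2 y\<^sub>2 x\<^sub>3 y\<^sub>3
  assume *: "(x\<^sub>1, y\<^sub>1) \<in> G" "(x\<^sub>2, y\<^sub>2) \<in> G" "(x\<^sub>3, y\<^sub>3) \<in> G" "x\<^sub>1 < x\<^sub>2" "x\<^sub>2 < x\<^sub>3" "y\<^sub>1 > y\<^sub>2" "y\<^sub>2 > y\<^sub>3"
  from *(1-3)[THEN shift_up_in_insert_point] show False
    by (rule graph_avoids_321D[OF assms]) (use * in simp_all)
qed

text \<open>One hypothesis for each role that the new point can play in an occurrence. Of the eight
  distributions of old and new points, those that use the new point more than once contradict the
  strict order.\<close>

lemma graph_avoids_321_insert_pointI:
  assumes G: "graph_avoids_321 G"
    and no_3: "\<And>x y x' y'. (x, y) \<in> G \<Longrightarrow> (x', y') \<in> G \<Longrightarrow> k \<le> x \<Longrightarrow> x < x' \<Longrightarrow> y' < y \<Longrightarrow> y < v \<Longrightarrow> False"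
    and no_2: "\<And>x y x' y'. (x, y) \<in> G \<Longrightarrow> (x', y') \<in> G \<Longrightarrow> x < k \<Longrightarrow> k \<le> x' \<Longrightarrow> y' < v \<Longrightarrow> v \<le> y \<Longrightarrow> False"
    and no_1: "\<And>x y x' y'. (x, y) \<in> G \<Longrightarrow> (x', y') \<in> G \<Longrightarrow> x < x' \<Longrightarrow> x' < k \<Longrightarrow> y' < y \<Longrightarrow> v \<le> y' \<Longrightarrow> False"
  shows "graph_avoids_321 (insert_point k v G)"
  unfolding graph_avoids_321_def mem_insert_point
proof (intro allI impI, elim disjE exE conjE, goal_cases)
  case 8
  then show False using graph_avoids_321D[OF G] by (metis shift_up_less(1))
next
  case 4
  then show False using no_3 by (metis shift_up_less)
next
  case 6
  then show False using no_2 by (metis shift_up_less)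
next
  case 7
  then show False using no_1 by (metis shift_up_less)
qed simp_all

definition tail_graphs_321 :: "int \<Rightarrow> int \<Rightarrow> int \<Rightarrow> (int \<times> int) set set" where
  "tail_graphs_321 m i j =
     {G \<in> perm_graphs m. graph_avoids_321 G \<and> (\<forall>x y. (x, y) \<in> G \<longrightarrow> m - i < x \<longrightarrow> y \<le> m - j)}"

lemma finite_tail_graphs_321: "finite (tail_graphs_321 m i j)"
  by (rule finite_subset[OF _ finite_perm_graphs[of m]]) (auto simp: tail_graphs_321_def)

lemma tail_graphs_321_0: "tail_graphs_321 m 0 0 = tail_graphs_321 m 1 0"
  by (force simp: tail_graphs_321_def dest: perm_graphs_bounds)

text \<open>This is path height \<open>2 * h\<close>. The last \<open>h\<close> values are at most
  \<open>m - h\<close>, so \<open>m\<close> lies further left and the final value is small. If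
  column \<open>m - h\<close> held a value strictly between \<open>m - h\<close> and
  \<open>m\<close>, then \<open>m\<close>, this value and the final value would form a 321. So
  either \<open>(m - h, m)\<close> is a point or the column joins the tail.\<close>

lemma tail_graphs_321_even:
  assumes h: "1 \<le> h" "h < m"
  shows "tail_graphs_321 m h h =
      insert_point (m - h) m ` tail_graphs_321 (m - 1) h (h - 1) \<union> tail_graphs_321 m (h + 1) h"
    and "insert_point (m - h) m ` tail_graphs_321 (m - 1) h (h - 1) \<inter> tail_graphs_321 m (h + 1) h = {}"
proof -
  define P where "P G \<longleftrightarrow> graph_avoids_321 G \<and> (\<forall>x y. (x, y) \<in> G \<longrightarrow> m - h < x \<longrightarrow> y \<le> m - h)" for G
  have "P (insert_point (m - h) m G) \<longleftrightarrow>
      graph_avoids_321 G \<and> (\<forall>x y. (x, y) \<in> G \<longrightarrow> m - 1 - h < x \<longrightarrow> y \<le> m - h)"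
    if G: "G \<in> perm_graphs (m - 1)" for G
  proof
    assume P: "P (insert_point (m - h) m G)"
    have "y \<le> m - h" if "(x, y) \<in> G" "m - 1 - h < x" for x y
    proof -
      have "(x + 1, y) \<in> insert_point (m - h) m G"
        using that perm_graphs_bounds[OF G that(1)] shift_up_in_insert_point[OF that(1), of "m - h" m]
        by (simp add: shift_up_def)
      then show ?thesis using P that(2) by (auto simp: P_def)
    qed
    with P show "graph_avoids_321 G \<and> (\<forall>x y. (x, y) \<in> G \<longrightarrow> m - 1 - h < x \<longrightarrow> y \<le> m - h)"
      using graph_avoids_321_insert_pointD by (auto simp: P_def)
  next
    assume G': "graph_avoids_321 G \<and> (\<forall>x y. (x, y) \<in> G \<longrightarrow> m - 1 - h < x \<longrightarrow> y \<le> m - h)"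
    have "graph_avoids_321 (insert_point (m - h) m G)"
    proof (rule graph_avoids_321_insert_pointI)
      fix x y x' y'
      assume xy: "(x, y) \<in> G" "(x', y') \<in> G" "m - h \<le> x" "x < x'" "y' < y" "y < m"
      have b: "x' \<le> m - 1" using perm_graphs_bounds[OF G xy(2)] by simp
      \<comment> \<open>A descent in the tail would already form a 321 with the largest value of
        \<open>G\<close>, which lies to the left of the tail; hence the new point cannot act as the
        3.\<close>
      obtain z where z: "(z, m - 1) \<in> G"
        using perm_graphs_ex_fst[OF G, of "m - 1"] h b xy by auto
      have "y \<le> m - h" using G' xy by auto
      moreover have "z < m - h"
        using G' z b xy by (smt (verit))
      moreover have "y < m - 1" using \<open>y \<le> m - h\<close> b xy by linarith
      ultimately show False
        using graph_avoids_321D[OF _ z xy(1,2)] G' xy b by (metis order_less_le_trans)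
    qed (use G' perm_graphs_bounds[OF G] in \<open>auto, force+\<close>)
    moreover have "y \<le> m - h" if "(x, y) \<in> insert_point (m - h) m G" "m - h < x" for x y
      using that G' perm_graphs_bounds[OF G]
      by (auto simp: mem_insert_point shift_up_def split: if_splits)
    ultimately show "P (insert_point (m - h) m G)" by (auto simp: P_def)
  qed
  then have eq: "{G \<in> perm_graphs m. (m - h, m) \<in> G \<and> P G} =
      insert_point (m - h) m ` tail_graphs_321 (m - 1) h (h - 1)"
    using perm_graphs_with_point[of "m - h" "m - 1" m P] h
    by (auto simp: tail_graphs_321_def cong: conj_cong)
  have bound: "y \<le> m - h" if G: "G \<in> perm_graphs m" "P G" "(m - h, m) \<notin> G" "(x, y) \<in> G" "m - (h + 1) < x" for G x y
  proof (cases "x = m - h")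
    case True
    show ?thesis
    proof (rule ccontr)
      assume y: "\<not> y \<le> m - h"
      obtain z where z: "(z, m) \<in> G"
        using perm_graphs_ex_fst[OF G(1), of m] h by auto
      obtain w where w: "(m, w) \<in> G"
        using perm_graphs_ex_snd[OF G(1), of m] h by auto
      have "w \<le> m - h" using G w h by (auto simp: P_def)
      moreover have "y \<noteq> m" using G True by auto
      moreover have "y \<le> m" using perm_graphs_bounds[OF G(1,4)] by simp
      moreover have "z \<noteq> x" using G True z by auto
      moreover have "z \<le> x" using G(2) True z h by (auto simp: P_def) force
      ultimately show False
        using graph_avoids_321D[OF _ z G(4) w] G(2) y h True by (auto simp: P_def)
    qed
  qed (use G in \<open>auto simp: P_def\<close>)
  have "{G \<in> tail_graphs_321 m h h. (m - h, m) \<notin> G} = tail_graphs_321 m (h + 1) h"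
  proof (intro equalityI subsetI)
    fix G assume "G \<in> {G \<in> tail_graphs_321 m h h. (m - h, m) \<notin> G}"
    then have "G \<in> perm_graphs m" "P G" "(m - h, m) \<notin> G"
      by (auto simp: tail_graphs_321_def P_def)
    with bound[OF this] show "G \<in> tail_graphs_321 m (h + 1) h"
      unfolding tail_graphs_321_def P_def by blast
  next
    fix G assume G: "G \<in> tail_graphs_321 m (h + 1) h"
    then have le: "y \<le> m - h" if "(x, y) \<in> G" "m - (h + 1) < x" for x y
      using that by (simp add: tail_graphs_321_def)
    have "(m - h, m) \<notin> G" using le[of "m - h" m] h by auto
    moreover have "y \<le> m - h" if "(x, y) \<in> G" "m - h < x" for x y
      using le[OF that(1)] that(2) by simp
    ultimately show "G \<in> {G \<in> tail_graphs_321 m h h. (m - h, m) \<notin> G}"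
      using G by (simp add: tail_graphs_321_def)
  qed
  moreover have "{G \<in> perm_graphs m. (m - h, m) \<in> G \<and> P G} = {G \<in> tail_graphs_321 m h h. (m - h, m) \<in> G}"
    by (auto simp: tail_graphs_321_def P_def)
  ultimately show "tail_graphs_321 m h h = insert_point (m - h) m ` tail_graphs_321 (m - 1) h (h - 1) \<union> tail_graphs_321 m (h + 1) h"
    and "insert_point (m - h) m ` tail_graphs_321 (m - 1) h (h - 1) \<inter> tail_graphs_321 m (h + 1) h = {}"
    unfolding eq by blast+
qed

text \<open>At path height \<open>2 * h + 1\<close> the value \<open>m - h\<close> decides. If it
  occurs among the last \<open>h + 1\<close> columns but before column \<open>m\<close>, then
  \<open>m\<close>, \<open>m - h\<close> and the smaller final value form a 321; so either
  \<open>(m, m - h)\<close> is a point or the bound on the tail improves by one.\<close>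

lemma tail_graphs_321_odd:
  assumes h: "0 \<le> h" "h < m"
  shows "tail_graphs_321 m (h + 1) h =
      insert_point m (m - h) ` tail_graphs_321 (m - 1) h h \<union> tail_graphs_321 m (h + 1) (h + 1)"
    and "insert_point m (m - h) ` tail_graphs_321 (m - 1) h h \<inter> tail_graphs_321 m (h + 1) (h + 1) = {}"
proof -
  define P where "P G \<longleftrightarrow> graph_avoids_321 G \<and> (\<forall>x y. (x, y) \<in> G \<longrightarrow> m - (h + 1) < x \<longrightarrow> y \<le> m - h)" for G
  have "P (insert_point m (m - h) G) \<longleftrightarrow>
      graph_avoids_321 G \<and> (\<forall>x y. (x, y) \<in> G \<longrightarrow> m - 1 - h < x \<longrightarrow> y \<le> m - 1 - h)"
    if G: "G \<in> perm_graphs (m - 1)" for G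
  proof
    assume P: "P (insert_point m (m - h) G)"
    have "y \<le> m - 1 - h" if "(x, y) \<in> G" "m - 1 - h < x" for x y
    proof -
      have "(x, shift_up (m - h) y) \<in> insert_point m (m - h) G"
        using that perm_graphs_bounds[OF G that(1)] shift_up_in_insert_point[OF that(1), of m "m - h"]
        by (simp add: shift_up_def)
      then have "shift_up (m - h) y \<le> m - h" using P that(2) by (auto simp: P_def)
      then show ?thesis by (auto simp: shift_up_def split: if_splits)
    qed
    with P show "graph_avoids_321 G \<and> (\<forall>x y. (x, y) \<in> G \<longrightarrow> m - 1 - h < x \<longrightarrow> y \<le> m - 1 - h)"
      using graph_avoids_321_insert_pointD by (auto simp: P_def)
  next
    assume G': "graph_avoids_321 G \<and> (\<forall>x y. (x, y) \<in> G \<longrightarrow> m - 1 - h < x \<longrightarrow> y \<le> m - 1 - h)"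
    have "graph_avoids_321 (insert_point m (m - h) G)"
    proof (rule graph_avoids_321_insert_pointI)
      fix x y x' y'
      assume xy: "(x, y) \<in> G" "(x', y') \<in> G" "x < x'" "x' < m" "y' < y" "m - h \<le> y'"
      have b: "1 \<le> x'" "y \<le> m - 1" using perm_graphs_bounds[OF G] xy by simp_all
      \<comment> \<open>A descent with values from \<open>m - h\<close> upwards lies to the left of
        the last \<open>h\<close> columns, so the final value of \<open>G\<close> already completes
        it to a 321.\<close>
      obtain z where z: "(m - 1, z) \<in> G"
        using perm_graphs_ex_snd[OF G, of "m - 1"] xy b by auto
      have "z \<le> m - 1 - h" using G' z b xy by auto
      moreover have "x' \<le> m - 1 - h" using G' xy by (smt (verit))
      ultimately show False
        using graph_avoids_321D[OF _ xy(1,2) z] G' xy b by auto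
    qed (use G' perm_graphs_bounds[OF G] in \<open>auto, force+\<close>)
    moreover have "y \<le> m - h" if "(x, y) \<in> insert_point m (m - h) G" "m - (h + 1) < x" for x y
      using that G' perm_graphs_bounds[OF G] h
      by (auto simp: mem_insert_point shift_up_def split: if_splits) force+
    ultimately show "P (insert_point m (m - h) G)" by (auto simp: P_def)
  qed
  then have eq: "{G \<in> perm_graphs m. (m, m - h) \<in> G \<and> P G} =
      insert_point m (m - h) ` tail_graphs_321 (m - 1) h h"
    using perm_graphs_with_point[of m "m - 1" "m - h" P] h
    by (auto simp: tail_graphs_321_def cong: conj_cong)
  have bound: "y \<le> m - (h + 1)" if G: "G \<in> perm_graphs m" "P G" "(m, m - h) \<notin> G" "(x, y) \<in> G" "m - (h + 1) < x" for G x y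
  proof (rule ccontr)
    assume "\<not> y \<le> m - (h + 1)"
    with G(2,4,5) have y: "y = m - h" by (force simp: P_def)
    have x: "x < m" using perm_graphs_bounds[OF G(1,4)] G(3,4) y by (cases "x = m") auto
    obtain z where z: "(z, m) \<in> G"
      using perm_graphs_ex_fst[OF G(1), of m] h by auto
    obtain w where w: "(m, w) \<in> G"
      using perm_graphs_ex_snd[OF G(1), of m] h by auto
    have "w \<le> m - h" using G(2) w h by (auto simp: P_def)
    moreover have "w \<noteq> m - h" using w G(3) by auto
    moreover have "z \<le> m - (h + 1)" using G(2) z x G(5) by (auto simp: P_def) force
    ultimately show False
      using graph_avoids_321D[OF _ z G(4) w] G(2,5) y h x by (auto simp: P_def)
  qed
  have "{G \<in> tail_graphs_321 m (h + 1) h. (m, m - h) \<notin> G} = tail_graphs_321 m (h + 1) (h + 1)"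
  proof (intro equalityI subsetI)
    fix G assume "G \<in> {G \<in> tail_graphs_321 m (h + 1) h. (m, m - h) \<notin> G}"
    then have "G \<in> perm_graphs m" "P G" "(m, m - h) \<notin> G"
      by (auto simp: tail_graphs_321_def P_def)
    with bound[OF this] show "G \<in> tail_graphs_321 m (h + 1) (h + 1)"
      unfolding tail_graphs_321_def P_def by blast
  next
    fix G assume G: "G \<in> tail_graphs_321 m (h + 1) (h + 1)"
    then have le: "y \<le> m - (h + 1)" if "(x, y) \<in> G" "m - (h + 1) < x" for x y
      using that by (simp add: tail_graphs_321_def)
    have "(m, m - h) \<notin> G" using le[of m "m - h"] h by auto
    moreover have "y \<le> m - h" if "(x, y) \<in> G" "m - (h + 1) < x" for x y
      using le[OF that(1)] that(2) by simp
    ultimately show "G \<in> {G \<in> tail_graphs_321 m (h + 1) h. (m, m - h) \<notin> G}"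
      using G by (simp add: tail_graphs_321_def)
  qed
  moreover have "{G \<in> perm_graphs m. (m, m - h) \<in> G \<and> P G} = {G \<in> tail_graphs_321 m (h + 1) h. (m, m - h) \<in> G}"
    by (auto simp: tail_graphs_321_def P_def)
  ultimately show "tail_graphs_321 m (h + 1) h = insert_point m (m - h) ` tail_graphs_321 (m - 1) h h \<union> tail_graphs_321 m (h + 1) (h + 1)"
    and "insert_point m (m - h) ` tail_graphs_321 (m - 1) h h \<inter> tail_graphs_321 m (h + 1) (h + 1) = {}"
    unfolding eq by blast+
qed

text \<open>The columns that move carry values at most \<open>m - h\<close>, hence points weakly
  below the diagonal both before and after, and old crossings persist. The new point is crossed by
  the points with values \<open>m - h + 1\<close> to \<open>m - 1\<close>, all of which lie to its
  left.\<close>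

lemma crossings_tail_graphs_321_even:
  assumes G: "G \<in> tail_graphs_321 (m - 1) h (h - 1)" and h: "1 \<le> h" "h < m"
  shows "crossings 0 (insert_point (m - h) m G) = crossings 0 G + nat (h - 1)"
proof -
  let ?u = "map_prod (shift_up (m - h)) (shift_up m)"
  have perm: "G \<in> perm_graphs (m - 1)" using G by (simp add: tail_graphs_321_def)
  have tail: "y \<le> m - h" if "(x, y) \<in> G" "m - h \<le> x" for x y
    using G that by (auto simp: tail_graphs_321_def)
  have "crossings 0 (insert_point (m - h) m G) =
      crossings 0 G + card {p \<in> G. crosses 0 (?u p) (m - h, m)}"
  proof (rule crossings_insert_point_unaffected)
    show "crosses 0 (?u p) (?u r) \<longleftrightarrow> crosses 0 p r" if "p \<in> G" "r \<in> G" for p r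
    proof -
      obtain x y x' y' where pr: "p = (x, y)" "r = (x', y')" by (cases p; cases r) auto
      show ?thesis
        using that tail[of x y] tail[of x' y'] perm_graphs_bounds[OF perm, of x y]
          perm_graphs_bounds[OF perm, of x' y']
        unfolding pr by (auto simp: shift_up_def)
    qed
    show "\<not> crosses 0 (m - h, m) (?u r)" if "r \<in> G" for r
      using that perm_graphs_bounds[OF perm, of "fst r" "snd r"]
      by (cases r) (auto simp: shift_up_def)
  qed (rule finite_perm_graph[OF perm])
  also have "{p \<in> G. crosses 0 (?u p) (m - h, m)} = {p \<in> G. snd p \<in> {m - h <.. m - 1}}"
  proof (rule Collect_cong, rule conj_cong[OF refl])
    fix p assume "p \<in> G"
    then show "crosses 0 (?u p) (m - h, m) \<longleftrightarrow> snd p \<in> {m - h <.. m - 1}"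
      using tail[of "fst p" "snd p"] perm_graphs_bounds[OF perm, of "fst p" "snd p"]
      by (cases p) (auto simp: shift_up_def)
  qed
  also have "card \<dots> = nat (h - 1)"
    by (subst card_perm_graph_snd[OF perm]) (use h in auto)
  finally show ?thesis .
qed

text \<open>The rows that move carry points to the left of column \<open>m - h\<close>, which stay
  strictly above the diagonal. The new point is crossed by the points in columns
  \<open>m - h\<close> to \<open>m - 1\<close>, since their values are all below
  \<open>m - h\<close>.\<close>

lemma crossings_tail_graphs_321_odd:
  assumes G: "G \<in> tail_graphs_321 (m - 1) h h" and h: "0 \<le> h" "h < m"
  shows "crossings 0 (insert_point m (m - h) G) = crossings 0 G + nat h"
proof -
  let ?u = "map_prod (shift_up m) (shift_up (m - h))"
  have perm: "G \<in> perm_graphs (m - 1)" using G by (simp add: tail_graphs_321_def)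
  have tail: "x < m - h \<or> y < m - h" if "(x, y) \<in> G" for x y
    using G that by (force simp: tail_graphs_321_def)
  have "crossings 0 (insert_point m (m - h) G) =
      crossings 0 G + card {p \<in> G. crosses 0 (?u p) (m, m - h)}"
  proof (rule crossings_insert_point_unaffected)
    show "crosses 0 (?u p) (?u r) \<longleftrightarrow> crosses 0 p r" if "p \<in> G" "r \<in> G" for p r
    proof -
      obtain x y x' y' where pr: "p = (x, y)" "r = (x', y')" by (cases p; cases r) auto
      show ?thesis
        using that tail[of x y] tail[of x' y'] perm_graphs_bounds[OF perm, of x y]
          perm_graphs_bounds[OF perm, of x' y']
        unfolding pr by (auto simp: shift_up_def)
    qed
    show "\<not> crosses 0 (m, m - h) (?u r)" if "r \<in> G" for r
      using that perm_graphs_bounds[OF perm, of "fst r" "snd r"]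
      by (cases r) (auto simp: shift_up_def)
  qed (rule finite_perm_graph[OF perm])
  also have "{p \<in> G. crosses 0 (?u p) (m, m - h)} = {p \<in> G. fst p \<in> {m - h .. m - 1}}"
  proof (rule Collect_cong, rule conj_cong[OF refl])
    fix p assume "p \<in> G"
    then show "crosses 0 (?u p) (m, m - h) \<longleftrightarrow> fst p \<in> {m - h .. m - 1}"
      using tail[of "fst p" "snd p"] perm_graphs_bounds[OF perm, of "fst p" "snd p"]
      by (cases p) (auto simp: shift_up_def)
  qed
  also have "card \<dots> = nat h"
    by (subst card_perm_graph_fst[OF perm]) (use h in auto)
  finally show ?thesis .
qed

lemma sum_tail_graphs_321:
  assumes "int t + i + j = 2 * m" "0 \<le> j" "i = j \<or> i = j + 1"
  shows "(\<Sum>G\<in>tail_graphs_321 m i j. [:0, 1:] ^ crossings 0 G) =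
    path_weight level_weight t (nat (i + j))"
  using assms
proof (induction t arbitrary: i j m)
  case 0
  then have ij: "i = m" "j = m" by presburger+
  \<comment> \<open>For positive \<open>m\<close> the last column would need a value at most
    0.\<close>
  have "tail_graphs_321 m m m = (if m = 0 then {{}} else {})"
  proof (cases "m = 0")
    case True
    then show ?thesis
      by (intro set_eqI) (auto simp: tail_graphs_321_def perm_graphs_0 graph_avoids_321_def)
  next
    case False
    have "G \<notin> tail_graphs_321 m m m" for G
    proof
      assume G: "G \<in> tail_graphs_321 m m m"
      then have perm: "G \<in> perm_graphs m" by (simp add: tail_graphs_321_def)
      obtain y where y: "(m, y) \<in> G"
        using perm_graphs_ex_snd[OF perm, of m] False ij 0 by auto
      with G perm_graphs_bounds[OF perm y] show False
        by (force simp: tail_graphs_321_def)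
    qed
    with False show ?thesis by auto
  qed
  with ij 0 show ?case by (auto simp: crossings_def)
next
  case (Suc t)
  let ?q = "[:0, 1:] :: int poly"
  have split: "(\<Sum>G\<in>A. ?q ^ crossings 0 G) =
      ?q ^ e * (\<Sum>G\<in>B. ?q ^ crossings 0 G) + (\<Sum>G\<in>C. ?q ^ crossings 0 G)"
    if "A = insert_point k v ` B \<union> C" "insert_point k v ` B \<inter> C = {}" "finite B" "finite C"
      "\<And>G. G \<in> B \<Longrightarrow> crossings 0 (insert_point k v G) = crossings 0 G + e" for A B C k v e
    using that by (simp add: sum.union_disjoint sum.reindex[OF inj_insert_point] power_add
      sum_distrib_left mult.commute)
  consider "i = 0" "j = 0" | h where "i = h" "j = h" "1 \<le> h" | h where "i = h + 1" "j = h" "0 \<le> h"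
    using Suc.prems by fastforce
  then show ?case
  proof cases
    case 1
    \<comment> \<open>At height 0 both tail conditions are vacuous, which matches the forced last
      step down from height 1.\<close>
    with Suc.prems Suc.IH[where i = 1 and j = 0 and m = m] show ?thesis
      by (simp add: tail_graphs_321_0)
  next
    case (2 h)
    define n where "n = nat (h - 1)"
    have nats: "nat (h - 1) = n" "nat (h + (h - 1)) = Suc (2 * n)"
      "nat (h + h) = Suc (Suc (2 * n))" "nat (h + 1 + h) = Suc (Suc (Suc (2 * n)))"
      using 2 by (simp_all add: n_def)
    have "h < m" using 2 Suc.prems by presburger
    with 2 have "(\<Sum>G\<in>tail_graphs_321 m h h. ?q ^ crossings 0 G) =
        ?q ^ nat (h - 1) * (\<Sum>G\<in>tail_graphs_321 (m - 1) h (h - 1). ?q ^ crossings 0 G) +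
        (\<Sum>G\<in>tail_graphs_321 m (h + 1) h. ?q ^ crossings 0 G)"
      by (intro split[where k = "m - h" and v = m] tail_graphs_321_even finite_tail_graphs_321 crossings_tail_graphs_321_even)
    also have "(\<Sum>G\<in>tail_graphs_321 (m - 1) h (h - 1). ?q ^ crossings 0 G) =
        path_weight level_weight t (nat (h + (h - 1)))"
      using 2 Suc.prems by (intro Suc.IH) auto
    also have "(\<Sum>G\<in>tail_graphs_321 m (h + 1) h. ?q ^ crossings 0 G) =
        path_weight level_weight t (nat (h + 1 + h))"
      using 2 Suc.prems by (intro Suc.IH) auto
    finally show ?thesis
      unfolding 2(1,2) nats by simp
  next
    case (3 h)
    define n where "n = nat h"
    have nats: "nat h = n" "nat (h + h) = 2 * n"
      "nat (h + 1 + h) = Suc (2 * n)" "nat (h + 1 + (h + 1)) = Suc (Suc (2 * n))"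
      using 3 by (simp_all add: n_def)
    have "h < m" using 3 Suc.prems by presburger
    with 3 have "(\<Sum>G\<in>tail_graphs_321 m (h + 1) h. ?q ^ crossings 0 G) =
        ?q ^ nat h * (\<Sum>G\<in>tail_graphs_321 (m - 1) h h. ?q ^ crossings 0 G) +
        (\<Sum>G\<in>tail_graphs_321 m (h + 1) (h + 1). ?q ^ crossings 0 G)"
      by (intro split[where k = m and v = "m - h"] tail_graphs_321_odd finite_tail_graphs_321 crossings_tail_graphs_321_odd)
    also have "(\<Sum>G\<in>tail_graphs_321 (m - 1) h h. ?q ^ crossings 0 G) =
        path_weight level_weight t (nat (h + h))"
      using 3 Suc.prems by (intro Suc.IH) auto
    also have "(\<Sum>G\<in>tail_graphs_321 m (h + 1) (h + 1). ?q ^ crossings 0 G) =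
        path_weight level_weight t (nat (h + 1 + (h + 1)))"
      using 3 Suc.prems by (intro Suc.IH) auto
    finally show ?thesis
      unfolding 3(1,2) nats by simp
  qed
qed

lemma sum_graphs_avoiding_321:
  "(\<Sum>G | G \<in> perm_graphs (int n) \<and> graph_avoids_321 G. [:0, 1:] ^ crossings 0 G) =
    path_weight level_weight (2 * n) 0"
proof -
  have "tail_graphs_321 (int n) 0 0 = {G. G \<in> perm_graphs (int n) \<and> graph_avoids_321 G}"
    by (auto simp: tail_graphs_321_def dest: perm_graphs_bounds)
  with sum_tail_graphs_321[of "2 * n" 0 0 "int n"] show ?thesis by simp
qed

section \<open>Avoiding 132\<close>

definition graph_avoids_132 :: "(int \<times> int) set \<Rightarrow> bool" where
  "graph_avoids_132 G \<longleftrightarrow> (\<forall>x\<^sub>1 y\<^sub>1 x\<^sub>2 y\<^sub>2 x\<^sub>3 y\<^sub>3.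
     (x\<^sub>1, y\<^sub>1) \<in> G \<longrightarrow> (x\<^sub>2, y\<^sub>2) \<in> G \<longrightarrow> (x\<^sub>3, y\<^sub>3) \<in> G \<longrightarrow>
     x\<^sub>1 < x\<^sub>2 \<longrightarrow> x\<^sub>2 < x\<^sub>3 \<longrightarrow> y\<^sub>1 < y\<^sub>3 \<longrightarrow> y\<^sub>3 < y\<^sub>2 \<longrightarrow> False)"

lemma graph_avoids_132D:
  assumes "graph_avoids_132 G" "(x\<^sub>1, y\<^sub>1) \<in> G" "(x\<^sub>2, y\<^sub>2) \<in> G" "(x\<^sub>3, y\<^sub>3) \<in> G"
    "x\<^sub>1 < x\<^sub>2" "x\<^sub>2 < x\<^sub>3" "y\<^sub>1 < y\<^sub>3" "y\<^sub>3 < y\<^sub>2"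
  shows False
  using assms unfolding graph_avoids_132_def by blast

lemma graph_avoids_132_insert_pointD:
  assumes "graph_avoids_132 (insert_point k v G)"
  shows "graph_avoids_132 G"
  unfolding graph_avoids_132_def
proof (intro allI impI)
  fix x\<^sub>1 y\<^sub>1 x\<^sub>2 y\<^sub>2 x\<^sub>3 y\<^sub>3
  assume *: "(x\<^sub>1, y\<^sub>1) \<in> G" "(x\<^sub>2, y\<^sub>2) \<in> G" "(x\<^sub>3, y\<^sub>3) \<in> G" "x\<^sub>1 < x\<^sub>2" "x\<^sub>2 < x\<^sub>3" "y\<^sub>1 < y\<^sub>3" "y\<^sub>3 < y\<^sub>2"
  from *(1-3)[THEN shift_up_in_insert_point] show False
    by (rule graph_avoids_132D[OF assms]) (use * in simp_all)
qed

lemma graph_avoids_132_insert_pointI: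
  assumes G: "graph_avoids_132 G"
    and no_1: "\<And>x y x' y'. (x, y) \<in> G \<Longrightarrow> (x', y') \<in> G \<Longrightarrow> k \<le> x \<Longrightarrow> x < x' \<Longrightarrow> v \<le> y' \<Longrightarrow> y' < y \<Longrightarrow> False"
    and no_3: "\<And>x y x' y'. (x, y) \<in> G \<Longrightarrow> (x', y') \<in> G \<Longrightarrow> x < k \<Longrightarrow> k \<le> x' \<Longrightarrow> y < y' \<Longrightarrow> y' < v \<Longrightarrow> False"
    and no_2: "\<And>x y x' y'. (x, y) \<in> G \<Longrightarrow> (x', y') \<in> G \<Longrightarrow> x < x' \<Longrightarrow> x' < k \<Longrightarrow> y < v \<Longrightarrow> v \<le> y' \<Longrightarrow> False"
  shows "graph_avoids_132 (insert_point k v G)"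
  unfolding graph_avoids_132_def mem_insert_point
proof (intro allI impI, elim disjE exE conjE, goal_cases)
  case 8
  then show False using graph_avoids_132D[OF G] by (metis shift_up_less(1))
next
  case 4
  then show False using no_1 by (metis shift_up_less)
next
  case 6
  then show False using no_3 by (metis shift_up_less)
next
  case 7
  then show False using no_2 by (metis shift_up_less)
qed simp_all

definition corner_graphs_132 :: "int \<Rightarrow> int \<Rightarrow> int \<Rightarrow> (int \<times> int) set set" where
  "corner_graphs_132 m a b =
     {G \<in> perm_graphs m. graph_avoids_132 G \<and>
        (1 \<le> a \<longrightarrow> (\<exists>y. (1, y) \<in> G \<and> y \<le> m + 1 - a)) \<and>
        (1 \<le> b \<longrightarrow> (\<exists>x. (x, 1) \<in> G \<and> x \<le> m + 1 - b)) \<and>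
        (1 \<le> a \<longrightarrow> 1 \<le> b \<longrightarrow> (m, m) \<notin> G)}"

lemma finite_corner_graphs_132: "finite (corner_graphs_132 m a b)"
  by (rule finite_subset[OF _ finite_perm_graphs[of m]]) (auto simp: corner_graphs_132_def)

lemma corner_graphs_132_empty:
  assumes "1 \<le> a" "m < a"
  shows "corner_graphs_132 m a b = {}"
  using assms by (force simp: corner_graphs_132_def dest: perm_graphs_bounds)

text \<open>The step at height 0: the bound for \<open>b = 1\<close> is vacuous, and the corner
  condition applies only when both parameters are positive.\<close>

lemma corner_graphs_132_0_0:
  assumes "1 \<le> m"
  shows "corner_graphs_132 m 0 0 = corner_graphs_132 m 0 1"
proof -
  have "\<exists>x. (x, 1) \<in> G \<and> x \<le> m" if "G \<in> perm_graphs m" for G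
    using perm_graphs_ex_fst[OF that, of 1] perm_graphs_bounds[OF that] assms by blast
  then show ?thesis by (auto simp: corner_graphs_132_def)
qed

section \<open>Symmetry under inversion\<close>

lemma bij_betw_swap_graph:
  "bij_betw f (prod.swap ` G) A \<longleftrightarrow> bij_betw (f \<circ> prod.swap) G A"
  by (rule bij_betw_comp_iff) (auto simp: bij_betw_def)

lemma swap_in_perm_graphs: "G \<in> perm_graphs m \<Longrightarrow> prod.swap ` G \<in> perm_graphs m"
  by (simp add: perm_graphs_def bij_betw_swap_graph comp_def)

lemma swap_graph_avoids_132: "graph_avoids_132 G \<Longrightarrow> graph_avoids_132 (prod.swap ` G)"
  unfolding graph_avoids_132_def[of "prod.swap ` G"]
  by (clarsimp, rule graph_avoids_132D)

lemma swap_in_corner_graphs_132: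
  assumes "G \<in> corner_graphs_132 m a b"
  shows "prod.swap ` G \<in> corner_graphs_132 m b a"
proof -
  have "(x, y) \<in> prod.swap ` G \<longleftrightarrow> (y, x) \<in> G" for x y by force
  with assms show ?thesis
    by (simp add: corner_graphs_132_def swap_in_perm_graphs swap_graph_avoids_132)
qed

text \<open>Transposition exchanges the two kinds of crossing. One is given by a strict inequality
  and the other by a weak one, which over the integers costs the extra 1.\<close>

lemma crossings_swap: "crossings s (prod.swap ` G) = crossings (1 - s) G"
proof -
  have eq: "crosses s (y, x) (y', x') \<longleftrightarrow> crosses (1 - s) (x, y) (x', y')" for x y x' y'
    by auto
  have "bij_betw (map_prod prod.swap prod.swap)
      {(p, r). p \<in> G \<and> r \<in> G \<and> crosses (1 - s) p r}
      {(p, r). p \<in> prod.swap ` G \<and> r \<in> prod.swap ` G \<and> crosses s p r}"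
    by (rule bij_betw_byWitness[where f' = "map_prod prod.swap prod.swap"])
      (auto simp: eq simp del: crosses.simps)
  then show ?thesis
    unfolding crossings_def by (rule bij_betw_same_card[symmetric])
qed

definition corner_sum :: "int \<Rightarrow> int \<Rightarrow> int \<Rightarrow> int \<Rightarrow> int poly" where
  "corner_sum s m a b = (\<Sum>G\<in>corner_graphs_132 m a b. [:0, 1:] ^ crossings s G)"

lemma corner_sum_swap: "corner_sum s m a b = corner_sum (1 - s) m b a"
  unfolding corner_sum_def
proof (rule sum.reindex_bij_witness[where i = "image prod.swap" and j = "image prod.swap"])
  fix G assume "G \<in> corner_graphs_132 m a b"
  then show "prod.swap ` G \<in> corner_graphs_132 m b a" by (rule swap_in_corner_graphs_132)
  show "[:0, 1:] ^ crossings (1 - s) (prod.swap ` G) = ([:0, 1:] :: int poly) ^ crossings s G"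
    by (simp add: crossings_swap)
  show "prod.swap ` prod.swap ` G = G" by (simp add: image_image)
next
  fix G assume "G \<in> corner_graphs_132 m b a"
  then show "prod.swap ` G \<in> corner_graphs_132 m a b" by (rule swap_in_corner_graphs_132)
  show "prod.swap ` prod.swap ` G = G" by (simp add: image_image)
qed

text \<open>With first value \<open>v\<close>, avoidance forces the higher values to increase. So
  after deletion the new first value is at most \<open>v\<close>: otherwise the value in row
  \<open>v\<close> would come later and form a descent with it. Conversely, a first value at most
  \<open>v\<close> in the avoiding smaller graph already forces the rows from \<open>v\<close>
  upwards to increase.\<close>

lemma corner_graphs_132_insert_first:
  assumes a: "1 \<le> a" "a \<le> m" and b: "0 \<le> b"
  shows "{G \<in> corner_graphs_132 m a b. (1, m + 1 - a) \<in> G} =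
    insert_point 1 (m + 1 - a) ` corner_graphs_132 (m - 1) (a - 1) b"
proof -
  define v where "v = m + 1 - a"
  have v: "1 \<le> v" "v \<le> m" using a by (auto simp: v_def)
  have "insert_point 1 v G \<in> corner_graphs_132 m a b \<longleftrightarrow> G \<in> corner_graphs_132 (m - 1) (a - 1) b"
    if G: "G \<in> perm_graphs (m - 1)" for G
  proof
    assume *: "insert_point 1 v G \<in> corner_graphs_132 m a b"
    then have av: "graph_avoids_132 (insert_point 1 v G)" by (simp add: corner_graphs_132_def)
    have incr: False if "(x, y) \<in> G" "(x', y') \<in> G" "x < x'" "v \<le> y'" "y' < y" for x y x' y'
    proof (rule graph_avoids_132D[OF av])
      show "(1, v) \<in> insert_point 1 v G" by (simp add: mem_insert_point)
      show "(shift_up 1 x, shift_up v y) \<in> insert_point 1 v G"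
        "(shift_up 1 x', shift_up v y') \<in> insert_point 1 v G"
        using that by (auto intro: shift_up_in_insert_point)
    qed (use that perm_graphs_bounds[OF G that(1)] in auto)
    have 1: "\<exists>y. (1, y) \<in> G \<and> y \<le> v" if a2: "1 \<le> a - 1"
    proof -
      have v': "v \<le> m - 1" using a2 by (simp add: v_def)
      obtain y where y: "(1, y) \<in> G"
        using perm_graphs_ex_snd[OF G order_refl] v' v(1) by fastforce
      obtain x where x: "(x, v) \<in> G"
        using perm_graphs_ex_fst[OF G v(1) v'] by blast
      have "y \<le> v"
      proof (rule ccontr)
        assume "\<not> y \<le> v"
        then have "x \<noteq> 1" using x y perm_graphs_unique_snd[OF G, of 1 y v] by auto
        with perm_graphs_bounds[OF G x] have "1 < x" by simp
        with incr[OF y x] \<open>\<not> y \<le> v\<close> show False by simp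
      qed
      with y show ?thesis by blast
    qed
    have corner: "(m - 1, m - 1) \<notin> G" if "1 \<le> a - 1" "1 \<le> b"
    proof
      assume "(m - 1, m - 1) \<in> G"
      from shift_up_in_insert_point[OF this, of 1 v] have "(m, m) \<in> insert_point 1 v G"
        using that a by (simp add: shift_up_def v_def)
      with * that a show False by (simp add: corner_graphs_132_def)
    qed
    \<comment> \<open>With \<open>v = 1\<close> all remaining points would increase, putting a point
      at \<open>(m, m)\<close>. Excluding this, the value 1 survives the deletion and only its
      column moves by one.\<close>
    have "v \<noteq> 1" if "1 \<le> b"
    proof
      assume v1: "v = 1"
      show False
      proof (cases "m = 1")
        case True
        with * that a v1 show False by (auto simp: corner_graphs_132_def mem_insert_point)
      next
        case False
        obtain x where x: "(x, m - 1) \<in> G"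
          using perm_graphs_ex_fst[OF G, of "m - 1"] False v by auto
        obtain y where y: "(m - 1, y) \<in> G"
          using perm_graphs_ex_snd[OF G, of "m - 1"] False v by auto
        have "x < m - 1"
          using corner that False v1 x perm_graphs_bounds[OF G x] by (cases "x = m - 1") (auto simp: v_def)
        moreover have "y < m - 1"
          using corner that False v1 y perm_graphs_bounds[OF G y] by (cases "y = m - 1") (auto simp: v_def)
        ultimately show False
          using incr[OF x y] v1 perm_graphs_bounds[OF G y] by simp
      qed
    qed
    then have 2: "\<exists>x. (x, 1) \<in> G \<and> x \<le> m - b" if b1: "1 \<le> b"
    proof -
      have "v \<noteq> 1" using \<open>1 \<le> b \<Longrightarrow> v \<noteq> 1\<close> b1 .
      obtain x where x: "(x, 1) \<in> insert_point 1 v G" "x \<le> m + 1 - b"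
        using * b1 by (auto simp: corner_graphs_132_def)
      with \<open>v \<noteq> 1\<close> obtain x' y' where
        x': "(x', y') \<in> G" "x = shift_up 1 x'" "1 = shift_up v y'"
        unfolding mem_insert_point by blast
      from x' perm_graphs_bounds[OF G x'(1)] have "y' = 1" "x = x' + 1"
        by (auto simp: shift_up_def split: if_splits)
      with x x' show ?thesis by auto
    qed
    have eqs: "m - 1 + 1 - (a - 1) = v" "m - 1 + 1 - b = m - b" by (simp_all add: v_def)
    show "G \<in> corner_graphs_132 (m - 1) (a - 1) b"
      unfolding corner_graphs_132_def mem_Collect_eq eqs
      using G 1 2 corner graph_avoids_132_insert_pointD[OF av] by blast
  next
    assume *: "G \<in> corner_graphs_132 (m - 1) (a - 1) b"
    have "graph_avoids_132 (insert_point 1 v G)"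
    proof (rule graph_avoids_132_insert_pointI)
      show G': "graph_avoids_132 G" using * by (simp add: corner_graphs_132_def)
      fix x y x' y'
      assume xy: "(x, y) \<in> G" "(x', y') \<in> G" "x < x'" "v \<le> y'" "y' < y"
      have "2 \<le> a" using perm_graphs_bounds[OF G xy(1)] xy by (simp add: v_def)
      with * obtain z where z: "(1, z) \<in> G" "z \<le> v"
        by (auto simp: corner_graphs_132_def v_def)
      have "x \<noteq> 1" using z xy perm_graphs_unique_snd[OF G, of 1 z y] by auto
      with perm_graphs_bounds[OF G xy(1)] have "1 < x" by simp
      moreover have "z \<noteq> y'"
        using z(1) xy perm_graphs_unique_fst[OF G, of 1 z x'] \<open>1 < x\<close> by auto
      ultimately show False
        using graph_avoids_132D[OF G' z(1) xy(1,2)] z(2) xy by simp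
    qed (use perm_graphs_bounds[OF G] in force)+
    moreover have "\<exists>x. (x, 1) \<in> insert_point 1 v G \<and> x \<le> m + 1 - b" if b1: "1 \<le> b"
    proof -
      obtain x where x: "(x, 1) \<in> G" "x \<le> m - b"
        using * b1 by (auto simp: corner_graphs_132_def)
      show ?thesis
      proof (cases "v = 1")
        case True
        with x perm_graphs_bounds[OF G x(1)] show ?thesis by (auto simp: mem_insert_point)
      next
        case False
        with x shift_up_in_insert_point[OF x(1), of 1 v] v perm_graphs_bounds[OF G x(1)]
        show ?thesis by (auto simp: shift_up_def)
      qed
    qed
    moreover have "(m, m) \<notin> insert_point 1 v G" if "1 \<le> b"
    proof
      assume "(m, m) \<in> insert_point 1 v G"
      then consider "m = 1" | x' y' where "(x', y') \<in> G" "m = shift_up 1 x'" "m = shift_up v y'"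
        unfolding mem_insert_point by blast
      then show False
      proof cases
        case 1
        with * that perm_graphs_0[of "m - 1"] show False by (auto simp: corner_graphs_132_def)
      next
        case 2
        have x': "x' = m - 1"
          using 2(2) perm_graphs_bounds[OF G 2(1)] by (simp add: shift_up_def)
        have y': "y' = m - 1" "v \<le> m - 1"
          using 2(3) perm_graphs_bounds[OF G 2(1)] by (simp_all add: shift_up_def split: if_splits)
        have "1 \<le> a - 1" using y' by (simp add: v_def)
        with * that have "(m - 1, m - 1) \<notin> G" by (simp add: corner_graphs_132_def)
        with 2(1) x' y'(1) show False by simp
      qed
    qed
    moreover have "insert_point 1 v G \<in> perm_graphs m"
      using insert_point_in_perm_graphs_iff[of 1 "m - 1" v G] G v by simp
    moreover have "(1, v) \<in> insert_point 1 v G" by (simp add: mem_insert_point)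
    ultimately show "insert_point 1 v G \<in> corner_graphs_132 m a b"
      unfolding corner_graphs_132_def v_def[symmetric] by blast
  qed
  moreover have "{G \<in> corner_graphs_132 m a b. (1, v) \<in> G} =
      {G \<in> perm_graphs (m - 1 + 1). (1, v) \<in> G \<and> G \<in> corner_graphs_132 m a b}"
    by (auto simp: corner_graphs_132_def)
  moreover have "corner_graphs_132 (m - 1) (a - 1) b =
      {G \<in> perm_graphs (m - 1). G \<in> corner_graphs_132 (m - 1) (a - 1) b}"
    by (auto simp: corner_graphs_132_def)
  ultimately show ?thesis
    using perm_graphs_with_point[of 1 "m - 1" v "\<lambda>G. G \<in> corner_graphs_132 m a b"] v
    unfolding v_def[symmetric] by (simp cong: conj_cong)
qed

text \<open>The largest value in the last column takes part in no occurrence of 132. Size and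
  \<open>b\<close> drop together, so the bound \<open>m + 1 - b\<close> on the column of the value 1
  stays the same.\<close>

lemma corner_graphs_132_insert_last:
  assumes m: "1 \<le> m" and b: "1 \<le> b"
  shows "{G \<in> corner_graphs_132 m 0 b. (m, m) \<in> G} =
    insert_point m m ` corner_graphs_132 (m - 1) 0 (b - 1)"
proof -
  have "insert_point m m G \<in> corner_graphs_132 m 0 b \<longleftrightarrow> G \<in> corner_graphs_132 (m - 1) 0 (b - 1)"
    if G: "G \<in> perm_graphs (m - 1)" for G
  proof -
    have up: "shift_up m x = x" "shift_up m y = y" if "(x, y) \<in> G" for x y
      using perm_graphs_bounds[OF G that] by (auto simp: shift_up_def)
    have mem: "(x, y) \<in> insert_point m m G \<longleftrightarrow> x = m \<and> y = m \<or> (x, y) \<in> G" for x y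
      using up unfolding mem_insert_point by metis
    have "graph_avoids_132 (insert_point m m G)" if "graph_avoids_132 G"
    proof (rule graph_avoids_132_insert_pointI[OF that])
    qed (use perm_graphs_bounds[OF G] in force)+
    then have av: "graph_avoids_132 (insert_point m m G) \<longleftrightarrow> graph_avoids_132 G"
      using graph_avoids_132_insert_pointD by blast
    have perm: "insert_point m m G \<in> perm_graphs m"
      using insert_point_in_perm_graphs_iff[of m "m - 1" m G] G m by simp
    have pos: "(\<exists>x. (x, 1) \<in> insert_point m m G \<and> x \<le> m + 1 - b) \<longleftrightarrow>
        (1 \<le> b - 1 \<longrightarrow> (\<exists>x. (x, 1) \<in> G \<and> x \<le> m + 1 - b))"
    proof (cases "b = 1")
      case True
      obtain x where "(x, 1) \<in> insert_point m m G"
        using perm_graphs_ex_fst[OF perm order_refl m] by blast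
      with True perm_graphs_bounds[OF perm this] show ?thesis by auto
    next
      case False
      with b show ?thesis by (auto simp: mem)
    qed
    have eq: "m - 1 + 1 - (b - 1) = m + 1 - b" by simp
    show ?thesis
      unfolding corner_graphs_132_def mem_Collect_eq eq using G perm av pos b by simp
  qed
  moreover have "{G \<in> corner_graphs_132 m 0 b. (m, m) \<in> G} =
      {G \<in> perm_graphs (m - 1 + 1). (m, m) \<in> G \<and> G \<in> corner_graphs_132 m 0 b}"
    by (auto simp: corner_graphs_132_def)
  moreover have "corner_graphs_132 (m - 1) 0 (b - 1) =
      {G \<in> perm_graphs (m - 1). G \<in> corner_graphs_132 (m - 1) 0 (b - 1)}"
    by (auto simp: corner_graphs_132_def)
  ultimately show ?thesis
    using perm_graphs_with_point[of m "m - 1" m "\<lambda>G. G \<in> corner_graphs_132 m 0 b"] m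
    by (simp cong: conj_cong)
qed

text \<open>Since \<open>s <= 0\<close>, the new point is not above the shifted diagonal and is
  crossed exactly by the points in columns \<open>m + s\<close> to \<open>m - 1\<close>;
  \<open>1 <= m + s\<close> keeps these columns inside the graph.\<close>

lemma crossings_insert_last:
  assumes perm: "G \<in> perm_graphs (m - 1)" and s: "s \<le> 0" "1 \<le> m + s"
  shows "crossings s (insert_point m m G) = crossings s G + nat (- s)"
proof -
  let ?u = "map_prod (shift_up m) (shift_up m)"
  have u: "?u p = p" if "p \<in> G" for p
    using perm_graphs_bounds[OF perm, of "fst p" "snd p"] that by (cases p) (auto simp: shift_up_def)
  have "crossings s (insert_point m m G) =
      crossings s G + card {p \<in> G. crosses s (?u p) (m, m)}"
  proof (rule crossings_insert_point_unaffected)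
    show "\<not> crosses s (m, m) (?u r)" if "r \<in> G" for r
      using u[OF that] perm_graphs_bounds[OF perm, of "fst r" "snd r"] that by (cases r) auto
  qed (simp_all only: u finite_perm_graph[OF perm])
  also have "{p \<in> G. crosses s (?u p) (m, m)} = {p \<in> G. fst p \<in> {m + s .. m - 1}}"
  proof (rule Collect_cong, rule conj_cong[OF refl])
    fix p assume "p \<in> G"
    then show "crosses s (?u p) (m, m) \<longleftrightarrow> fst p \<in> {m + s .. m - 1}"
      unfolding u[OF \<open>p \<in> G\<close>]
      using perm_graphs_bounds[OF perm, of "fst p" "snd p"] s by (cases p) auto
  qed
  also have "card \<dots> = nat (- s)"
    by (subst card_perm_graph_fst[OF perm]) (use s in auto)
  finally show ?thesis .
qed

text \<open>Here \<open>G\<close> is what remains after deleting the first column. Its first value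
  is at most \<open>m + 1 - a\<close>, so a descent among the rows from there upwards would complete
  a 132.\<close>

lemma corner_graphs_132_top_increasing:
  assumes G: "G \<in> corner_graphs_132 (m - 1) (a - 1) b"
    and xy: "(x, y) \<in> G" "(x', y') \<in> G" "m + 1 - a \<le> y" "y < y'"
  shows "x < x'"
proof (rule ccontr)
  assume "\<not> x < x'"
  have perm: "G \<in> perm_graphs (m - 1)" and av: "graph_avoids_132 G"
    using G by (auto simp: corner_graphs_132_def)
  have "x \<noteq> x'" using perm_graphs_unique_snd[OF perm, of x y y'] xy by auto
  with \<open>\<not> x < x'\<close> have "x' < x" by simp
  have "2 \<le> a" using perm_graphs_bounds[OF perm xy(2)] xy by simp
  with G obtain z where z: "(1, z) \<in> G" "z \<le> m + 1 - a"
    by (auto simp: corner_graphs_132_def)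
  have "x' \<noteq> 1" using perm_graphs_unique_snd[OF perm, of 1 z y'] z xy by auto
  with perm_graphs_bounds[OF perm xy(2)] have "1 < x'" by simp
  have "z \<noteq> y" using perm_graphs_unique_fst[OF perm, of 1 z x] z(1) xy(1) \<open>1 < x'\<close> \<open>x' < x\<close> by auto
  with z xy have "z < y" by simp
  show False
    by (rule graph_avoids_132D[OF av z(1) xy(2) xy(1) \<open>1 < x'\<close> \<open>x' < x\<close> \<open>z < y\<close> xy(4)])
qed

text \<open>In the top row with \<open>b >= 1\<close>, the excluded corner leaves a smaller last
  value, so the maximum must precede the value 1, whose column is at most \<open>m - b\<close>. Each
  further row down lies at least one column to the left by
  \<open>corner_graphs_132_top_increasing\<close>.\<close>

lemma corner_graphs_132_top_bound:
  assumes G: "G \<in> corner_graphs_132 (m - 1) (a - 1) b" and b: "0 \<le> b"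
    and xy: "(x, y) \<in> G" "m + 1 - a \<le> y"
  shows "x \<le> y - b"
proof -
  have perm: "G \<in> perm_graphs (m - 1)" and av: "graph_avoids_132 G"
    using G by (auto simp: corner_graphs_132_def)
  have "x \<le> m - 1 - int k - b" if "(x, m - 1 - int k) \<in> G" "m + 1 - a \<le> m - 1 - int k" for x k
    using that
  proof (induction k arbitrary: x)
    case 0
    then have x: "(x, m - 1) \<in> G" and a: "2 \<le> a" by simp_all
    note bounds = perm_graphs_bounds[OF perm x]
    show ?case
    proof (cases "b = 0")
      case True
      with bounds show ?thesis by simp
    next
      case False
      with b G obtain p where p: "(p, 1) \<in> G" "p \<le> m - b"
        by (auto simp: corner_graphs_132_def)
      have corner: "(m - 1, m - 1) \<notin> G"
        using G a False b by (simp add: corner_graphs_132_def)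
      then have "x < m - 1" using x bounds by (cases "x = m - 1") auto
      obtain w where w: "(m - 1, w) \<in> G"
        using perm_graphs_ex_snd[OF perm, of "m - 1"] bounds by auto
      have "w \<noteq> m - 1" using corner w by auto
      have "x < p"
      proof (rule ccontr)
        assume "\<not> x < p"
        have "w \<noteq> 1" using perm_graphs_unique_fst[OF perm, of "m - 1" 1 p] w p \<open>\<not> x < p\<close> \<open>x < m - 1\<close> by auto
        then have w': "1 < w" "w < m - 1" using perm_graphs_bounds[OF perm w] \<open>w \<noteq> m - 1\<close> by simp_all
        then have "p \<noteq> x" using perm_graphs_unique_snd[OF perm, of x 1 "m - 1"] p x by auto
        then have "p < x" using \<open>\<not> x < p\<close> by simp
        show False
          by (rule graph_avoids_132D[OF av p(1) x w \<open>p < x\<close> \<open>x < m - 1\<close> w'])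
      qed
      with p show ?thesis by simp
    qed
  next
    case (Suc k)
    have "1 \<le> m - 1 - int k" using perm_graphs_bounds[OF perm Suc.prems(1)] by simp
    then obtain x' where x': "(x', m - 1 - int k) \<in> G"
      using perm_graphs_ex_fst[OF perm, of "m - 1 - int k"] by auto
    have "x < x'"
      by (rule corner_graphs_132_top_increasing[OF G Suc.prems(1) x' Suc.prems(2)]) simp
    moreover have "x' \<le> m - 1 - int k - b"
      using Suc.IH[OF x'] Suc.prems(2) by simp
    ultimately show ?case by simp
  qed
  from this[of x "nat (m - 1 - y)"] show ?thesis
    using xy perm_graphs_bounds[OF perm xy(1)] by simp
qed

text \<open>A point \<open>r\<close> above the inserted one gains exactly one crossing: with the inserted point if
  the column of \<open>r\<close> lies far enough to the left, and otherwise with the one point whose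
  condition for crossing \<open>r\<close> becomes true by moving up relative to the diagonal.\<close>

lemma crossings_insert_first:
  assumes G: "G \<in> corner_graphs_132 (m - 1) (a - 1) b"
    and a: "1 \<le> a" "a \<le> m" and b: "0 \<le> b" and s: "a - b + 1 \<le> 2 * s"
  shows "crossings s (insert_point 1 (m + 1 - a) G) = crossings (s - 1) G + nat (a - 1)"
proof -
  define v where "v = m + 1 - a"
  let ?u = "map_prod (shift_up 1) (shift_up v)"
  have perm: "G \<in> perm_graphs (m - 1)" using G by (simp add: corner_graphs_132_def)
  note bounds = perm_graphs_bounds[OF perm]
  have fin: "finite G" by (rule finite_perm_graph[OF perm])
  have u: "?u (x, y) = (x + 1, if y < v then y else y + 1)" if "(x, y) \<in> G" for x y
    using bounds[OF that] by (simp add: shift_up_def)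
  have none: "{p \<in> G. crosses s (?u p) (1, v)} = {}"
  proof -
    have "\<not> crosses s (?u p) (1, v)" if "p \<in> G" for p
      using that u[of "fst p" "snd p"] bounds(1)[of "fst p" "snd p"] by (cases p) simp
    then show ?thesis by blast
  qed
  have gain: "of_bool (crosses s (1, v) (?u r)) + card {p \<in> G. crosses s (?u p) (?u r)} =
      card {p \<in> G. crosses (s - 1) p r} + of_bool (v \<le> snd r)" if r: "r \<in> G" for r
  proof -
    obtain x' y' where r_eq: "r = (x', y')" by (cases r)
    note r' = r[unfolded r_eq]
    show ?thesis
    proof (cases "y' < v")
      case True
      have "crosses s (?u p) (?u r) \<longleftrightarrow> crosses (s - 1) p r" if "p \<in> G" for p
      proof -
        obtain x y where p_eq: "p = (x, y)" by (cases p)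
        show ?thesis
          unfolding p_eq r_eq u[OF that[unfolded p_eq]] u[OF r'] using True by auto
      qed
      then have "{p \<in> G. crosses s (?u p) (?u r)} = {p \<in> G. crosses (s - 1) p r}" by blast
      moreover have "\<not> crosses s (1, v) (?u r)"
        unfolding r_eq u[OF r'] using True by simp
      ultimately show ?thesis using True by (simp add: r_eq)
    next
      case False
      have "x' \<le> y' - b"
        using corner_graphs_132_top_bound[OF G b r'] False by (simp add: v_def)
      moreover have "2 \<le> a" using False bounds[OF r'] by (simp add: v_def)
      \<comment> \<open>This puts \<open>r\<close> above the diagonal with a margin of one, so only
        the first alternative in \<open>crosses\<close> can hold for pairs ending in
        \<open>r\<close>, before and after the insertion.\<close>
      ultimately have x': "x' < y' + s - 1" using s b by linarith
      have u_r: "?u r = (x' + 1, y' + 1)" unfolding r_eq u[OF r'] using False by simp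
      \<comment> \<open>Passing from \<open>s - 1\<close> to \<open>s\<close> compensates the column
        shift for rows below \<open>v\<close>. A row from \<open>v\<close> upwards also moves up and
        gains one unit, which matters only at equality.\<close>
      have low: "crosses s (?u p) (?u r) \<longleftrightarrow> crosses (s - 1) p r"
        if "p = (x, y)" "p \<in> G" "y \<noteq> x' - s + 1 \<or> y < v" for p x y
        using that u[of x y] x' False unfolding u_r by (auto simp: r_eq)
      show ?thesis
      proof (cases "x' + 1 < v + s")
        case True
        have "crosses s (?u p) (?u r) \<longleftrightarrow> crosses (s - 1) p r" if "p \<in> G" for p
          using low[of p "fst p" "snd p"] that True by (cases p) fastforce
        then have "{p \<in> G. crosses s (?u p) (?u r)} = {p \<in> G. crosses (s - 1) p r}" by blast
        moreover have "crosses s (1, v) (?u r)"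
          unfolding u_r using True False bounds[OF r'] by simp
        ultimately show ?thesis using False by (simp add: r_eq)
      next
        case far: False
        define y\<^sub>0 where "y\<^sub>0 = x' - s + 1"
        have y\<^sub>0: "v \<le> y\<^sub>0" "y\<^sub>0 < y'" using far x' by (simp_all add: y\<^sub>0_def)
        then obtain x\<^sub>0 where x\<^sub>0: "(x\<^sub>0, y\<^sub>0) \<in> G"
          using perm_graphs_ex_fst[OF perm, of y\<^sub>0] a bounds[OF r'] by (auto simp: v_def)
        have "x\<^sub>0 < x'"
          using corner_graphs_132_top_increasing[OF G x\<^sub>0 r'] y\<^sub>0 by (simp add: v_def)
        have "crosses s (?u (x\<^sub>0, y\<^sub>0)) (?u r)"
          unfolding u_r u[OF x\<^sub>0] using y\<^sub>0 \<open>x\<^sub>0 < x'\<close> by (simp add: y\<^sub>0_def)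
        moreover have not: "\<not> crosses (s - 1) (x\<^sub>0, y\<^sub>0) r"
          unfolding r_eq using y\<^sub>0 \<open>x\<^sub>0 < x'\<close> x' by (simp add: y\<^sub>0_def)
        moreover have "crosses s (?u p) (?u r) \<longleftrightarrow> crosses (s - 1) p r"
          if p: "p \<in> G" "p \<noteq> (x\<^sub>0, y\<^sub>0)" for p
        proof (rule low[of p "fst p" "snd p"])
          show "snd p \<noteq> x' - s + 1 \<or> snd p < v"
            using perm_graphs_unique_fst[OF perm, of "fst p" y\<^sub>0 x\<^sub>0] p x\<^sub>0
            by (cases p) (auto simp: y\<^sub>0_def)
        qed (use p in simp_all)
        ultimately have "{p \<in> G. crosses s (?u p) (?u r)} =
            insert (x\<^sub>0, y\<^sub>0) {p \<in> G. crosses (s - 1) p r}"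
          using x\<^sub>0 by blast
        moreover have "\<not> crosses s (1, v) (?u r)"
          unfolding u_r using far x' bounds[OF r'] by simp
        moreover have "(x\<^sub>0, y\<^sub>0) \<notin> {p \<in> G. crosses (s - 1) p r}" using not by blast
        ultimately show ?thesis
          using False fin by (simp only: card_insert_disjoint finite_Collect_conjI) (simp add: r_eq)
      qed
    qed
  qed
  have "crossings s (insert_point 1 v G) =
      (\<Sum>r\<in>G. card {p \<in> G. crosses (s - 1) p r} + of_bool (v \<le> snd r))"
    unfolding crossings_insert_point[OF fin] none by (simp only: gain card.empty add_0 cong: sum.cong)
  also have "\<dots> = crossings (s - 1) G + card {p \<in> G. v \<le> snd p}"
    using fin by (simp add: sum.distrib crossings_eq_sum Int_def)
  also have "{p \<in> G. v \<le> snd p} = {p \<in> G. snd p \<in> {v .. m - 1}}"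
    using bounds by fastforce
  also have "card \<dots> = nat (a - 1)"
    by (subst card_perm_graph_snd[OF perm]) (use a in \<open>auto simp: v_def\<close>)
  finally show ?thesis unfolding v_def .
qed

lemma corner_sum_insert_first:
  assumes m: "1 \<le> m" and a: "1 \<le> a" and b: "0 \<le> b" and s: "a - b + 1 \<le> 2 * s"
  shows "corner_sum s m a b =
    [:0, 1:] ^ nat (a - 1) * corner_sum (s - 1) (m - 1) (a - 1) b + corner_sum s m (a + 1) b"
proof (cases "a \<le> m")
  case False
  \<comment> \<open>For \<open>a > m\<close> all three classes are empty; \<open>a - 1\<close> is
    still positive and exceeds \<open>m - 1\<close>.\<close>
  with m a corner_graphs_132_empty[of "a - 1" "m - 1" b] corner_graphs_132_empty[of a m b]
    corner_graphs_132_empty[of "a + 1" m b]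
  show ?thesis by (simp add: corner_sum_def)
next
  case True
  let ?A = "{G \<in> corner_graphs_132 m a b. (1, m + 1 - a) \<in> G}"
  have "{G \<in> corner_graphs_132 m a b. (1, m + 1 - a) \<notin> G} = corner_graphs_132 m (a + 1) b"
    (is "?L = ?R")
  proof (intro equalityI subsetI)
    fix G assume G: "G \<in> ?L"
    then obtain y where y: "(1, y) \<in> G" "y \<le> m + 1 - a"
      using a by (auto simp: corner_graphs_132_def)
    with G have "y \<noteq> m + 1 - a" by auto
    with y have "\<exists>y. (1, y) \<in> G \<and> y \<le> m + 1 - (a + 1)" by (intro exI[of _ y]) auto
    with G a show "G \<in> ?R" unfolding corner_graphs_132_def by simp
  next
    fix G assume G: "G \<in> ?R"
    then have perm: "G \<in> perm_graphs m" by (simp add: corner_graphs_132_def)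
    from G a obtain y where y: "(1, y) \<in> G" "y \<le> m + 1 - (a + 1)"
      by (auto simp: corner_graphs_132_def)
    then have "\<exists>y. (1, y) \<in> G \<and> y \<le> m + 1 - a" by (intro exI[of _ y]) auto
    moreover have "(1, m + 1 - a) \<notin> G"
      using perm_graphs_unique_snd[OF perm y(1), of "m + 1 - a"] y(2) by auto
    ultimately show "G \<in> ?L" using G a unfolding corner_graphs_132_def by simp
  qed
  then have "corner_sum s m a b =
      (\<Sum>G\<in>?A. [:0, 1:] ^ crossings s G) + corner_sum s m (a + 1) b"
    unfolding corner_sum_def
    by (subst sum.union_disjoint[symmetric])
      (auto intro!: sum.cong simp: finite_corner_graphs_132)
  also have "(\<Sum>G\<in>?A. [:0, 1:] ^ crossings s G) =
      ([:0, 1:] :: int poly) ^ nat (a - 1) * corner_sum (s - 1) (m - 1) (a - 1) b"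
    unfolding corner_graphs_132_insert_first[OF a True b] corner_sum_def
    by (simp add: sum.reindex[OF inj_insert_point] crossings_insert_first[OF _ a True b s]
        power_add sum_distrib_left mult.commute)
  finally show ?thesis .
qed

lemma corner_sum_insert_last:
  assumes m: "1 \<le> m" and b: "1 \<le> b" and s: "s \<le> 0" "1 - b \<le> 2 * s"
  shows "corner_sum s m 0 b =
    [:0, 1:] ^ nat (- s) * corner_sum s (m - 1) 0 (b - 1) + corner_sum s m 1 b"
proof -
  let ?A = "{G \<in> corner_graphs_132 m 0 b. (m, m) \<in> G}"
  have "{G \<in> corner_graphs_132 m 0 b. (m, m) \<notin> G} = corner_graphs_132 m 1 b"
    (is "?L = ?R")
  proof (intro equalityI subsetI)
    fix G assume G: "G \<in> ?L"
    then have perm: "G \<in> perm_graphs m" by (simp add: corner_graphs_132_def)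
    obtain y where y: "(1, y) \<in> G" using perm_graphs_ex_snd[OF perm order_refl m] by blast
    with perm_graphs_bounds[OF perm y] have "\<exists>y. (1, y) \<in> G \<and> y \<le> m + 1 - 1" by auto
    with G show "G \<in> ?R" unfolding corner_graphs_132_def by simp
  next
    fix G assume "G \<in> ?R"
    with b show "G \<in> ?L" unfolding corner_graphs_132_def by simp
  qed
  then have "corner_sum s m 0 b =
      (\<Sum>G\<in>?A. [:0, 1:] ^ crossings s G) + corner_sum s m 1 b"
    unfolding corner_sum_def
    by (subst sum.union_disjoint[symmetric])
      (auto intro!: sum.cong simp: finite_corner_graphs_132)
  also have "(\<Sum>G\<in>?A. [:0, 1:] ^ crossings s G) =
      ([:0, 1:] :: int poly) ^ nat (- s) * corner_sum s (m - 1) 0 (b - 1)"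
  proof -
    have "crossings s (insert_point m m G) = crossings s G + nat (- s)"
      if G: "G \<in> corner_graphs_132 (m - 1) 0 (b - 1)" for G
    proof (rule crossings_insert_last)
      show perm: "G \<in> perm_graphs (m - 1)" using G by (simp add: corner_graphs_132_def)
      \<comment> \<open>For \<open>b >= 2\<close> a member of the smaller class forces
        \<open>b <= m\<close>, and \<open>m + s\<close> is then at least
        \<open>(b + 1) / 2\<close>.\<close>
      show "1 \<le> m + s"
      proof (cases "b = 1")
        case True
        with s m show ?thesis by simp
      next
        case False
        with b G obtain x where x: "(x, 1) \<in> G" "x \<le> m - 1 + 1 - (b - 1)"
          by (auto simp: corner_graphs_132_def)
        with perm_graphs_bounds[OF perm x(1)] have "b \<le> m" by simp
        with s b show ?thesis by simp
      qed
    qed (rule s(1))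
    then show ?thesis
      unfolding corner_graphs_132_insert_last[OF m b] corner_sum_def
      by (simp add: sum.reindex[OF inj_insert_point] power_add sum_distrib_left mult.commute)
  qed
  finally show ?thesis .
qed

text \<open>Both parameters must equal \<open>m\<close>, so the first value is 1 and the last is not
  \<open>m\<close>; then 1, \<open>m\<close> and the last value form a 132. This is the base case of
  length 0 and positive height.\<close>

lemma corner_graphs_132_full:
  assumes "a + b = 2 * m" "1 \<le> m"
  shows "corner_graphs_132 m a b = {}"
proof -
  have False if G: "G \<in> corner_graphs_132 m a b" for G
  proof -
    have perm: "G \<in> perm_graphs m" and av: "graph_avoids_132 G"
      using G by (auto simp: corner_graphs_132_def)
    have le: "a \<le> m" if "1 \<le> a"
      using G that corner_graphs_132_empty[of a m b] by force
    have "b \<le> m" if "1 \<le> b"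
      using swap_in_corner_graphs_132[OF G] that corner_graphs_132_empty[of b m a] by force
    with le assms have ab: "a = m" "b = m" by linarith+
    with G assms(2) obtain y where y: "(1, y) \<in> G" "y \<le> 1" by (auto simp: corner_graphs_132_def)
    with perm_graphs_bounds[OF perm y(1)] have one: "(1, 1) \<in> G" by simp
    have corner: "(m, m) \<notin> G" using G ab assms(2) by (simp add: corner_graphs_132_def)
    obtain x where x: "(x, m) \<in> G" using perm_graphs_ex_fst[OF perm assms(2) order_refl] by blast
    obtain w where w: "(m, w) \<in> G" using perm_graphs_ex_snd[OF perm assms(2) order_refl] by blast
    have "m \<noteq> 1" using one corner by auto
    have "x < m" using corner x perm_graphs_bounds[OF perm x] by (cases "x = m") auto
    moreover have "w < m" using corner w perm_graphs_bounds[OF perm w] by (cases "w = m") auto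
    moreover have "1 < x"
      using perm_graphs_unique_snd[OF perm, of 1 1 m] one x \<open>m \<noteq> 1\<close> perm_graphs_bounds[OF perm x]
      by (cases "x = 1") auto
    moreover have "1 < w"
      using perm_graphs_unique_fst[OF perm, of 1 1 m] one w \<open>m \<noteq> 1\<close> perm_graphs_bounds[OF perm w]
      by (cases "w = 1") auto
    ultimately show False using graph_avoids_132D[OF av one x w] by simp
  qed
  then show ?thesis by blast
qed

text \<open>Takes the same value at \<open>s\<close> and \<open>1 - s\<close>, in accordance with
  \<open>corner_sum_swap\<close>; \<open>s * (s - 1)\<close> is nonnegative for every integer, so
  \<open>nat\<close> loses nothing.\<close>

definition triangular :: "int \<Rightarrow> nat" where
  "triangular s = nat (s * (s - 1) div 2)"

lemma triangular_add_1: "int (triangular (s + 1)) = int (triangular s) + s"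
proof -
  have "(s + 1) * (s + 1 - 1) = s * (s - 1) + s * 2" by (simp add: algebra_simps)
  then have "(s + 1) * (s + 1 - 1) div 2 = s * (s - 1) div 2 + s" by simp
  moreover have "0 \<le> s * (s - 1)" for s :: int
    by (cases "s \<le> 0") (auto simp: mult_nonpos_nonpos)
  then have "0 \<le> s * (s - 1) div 2" for s :: int by simp
  ultimately show ?thesis unfolding triangular_def by (metis int_nat_eq)
qed

text \<open>The parameter \<open>s\<close> is half of \<open>a - b\<close>, rounded up; up to a power of \<open>q\<close>, the sum
  depends only on \<open>m\<close> and \<open>a + b\<close>.\<close>

lemma corner_sum_eq_path_weight:
  assumes "int t + a + b = 2 * m" "0 \<le> a" "0 \<le> b" "2 * s = a - b \<or> 2 * s = a - b + 1"
  shows "corner_sum s m a b =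
    [:0, 1:] ^ triangular s * path_weight level_weight t (nat (a + b))"
  using assms
proof (induction t arbitrary: a b m s)
  case 0
  then have s: "2 * s = a - b" by presburger
  show ?case
  proof (cases "m = 0")
    case True
    with 0 s have "a = 0" "b = 0" "s = 0" by auto
    moreover have "corner_graphs_132 0 0 0 = {{}}"
      by (intro set_eqI) (auto simp: corner_graphs_132_def perm_graphs_0 graph_avoids_132_def)
    ultimately show ?thesis
      using True by (simp add: corner_sum_def crossings_def triangular_def)
  next
    case False
    with 0 have "1 \<le> m" by linarith
    with 0 show ?thesis by (simp add: corner_sum_def corner_graphs_132_full)
  qed
next
  case (Suc t)
  let ?q = "[:0, 1:] :: int poly"
  have m: "1 \<le> m" using Suc.prems by linarith
  \<comment> \<open>\<open>d\<close> is the number of crossings lost in a deletion and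
    \<open>s'\<close> the shift of the smaller graph; together they must produce the weight of an up
    step from height \<open>a + b - 1\<close>.\<close>
  have step: "?q ^ d * (?q ^ triangular s' * path_weight level_weight t (nat (a + b - 1))) +
      ?q ^ triangular s * path_weight level_weight t (nat (a + b + 1)) =
      ?q ^ triangular s * path_weight level_weight (Suc t) (nat (a + b))"
    if ab: "1 \<le> a + b"
      and e: "int d + int (triangular s') = int (triangular s) + (a + b - 1) div 2" for d s'
  proof -
    define h where "h = nat (a + b - 1)"
    have h: "nat (a + b) = Suc h" "nat (a + b + 1) = Suc (Suc h)" "a + b - 1 = int h"
      using ab by (simp_all add: h_def)
    from e have "d + triangular s' = triangular s + h div 2" unfolding h(3) by linarith
    then have "?q ^ d * ?q ^ triangular s' = ?q ^ triangular s * ?q ^ (h div 2)"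
      by (simp only: flip: power_add)
    then show ?thesis
      unfolding h path_weight.simps h_def[symmetric]
      by (simp only: distrib_left nat_int flip: mult.assoc)
  qed
  \<comment> \<open>Odd \<open>a - b\<close> calls for the first column and even
    \<open>a - b\<close> for the bottom row; \<open>last\<close> and \<open>last'\<close> take over
    when the parameter to be lowered is 0.\<close>
  consider (first) "2 * s = a - b + 1" "1 \<le> a"
    | (last) "2 * s = 1 - b" "a = 0" "1 \<le> b"
    | (bottom) "2 * s = a - b" "1 \<le> b"
    | (last') "2 * s = a" "b = 0" "2 \<le> a"
    | (origin) "s = 0" "a = 0" "b = 0"
  proof -
    have "2 * s = a - b + 1 \<and> 1 \<le> a \<or> 2 * s = 1 - b \<and> a = 0 \<and> 1 \<le> b \<or>
        2 * s = a - b \<and> 1 \<le> b \<or> 2 * s = a \<and> b = 0 \<and> 2 \<le> a \<or> s = 0 \<and> a = 0 \<and> b = 0"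
      using Suc.prems(2-4) by presburger
    then show thesis using first last bottom last' origin by blast
  qed
  then show ?case
  proof cases
    case first
    have "corner_sum s m a b =
        ?q ^ nat (a - 1) * corner_sum (s - 1) (m - 1) (a - 1) b + corner_sum s m (a + 1) b"
      using first Suc.prems m by (intro corner_sum_insert_first) auto
    also have "corner_sum (s - 1) (m - 1) (a - 1) b =
        ?q ^ triangular (s - 1) * path_weight level_weight t (nat (a - 1 + b))"
      using first Suc.prems by (intro Suc.IH) auto
    also have "corner_sum s m (a + 1) b =
        ?q ^ triangular s * path_weight level_weight t (nat (a + 1 + b))"
      using first Suc.prems by (intro Suc.IH) auto
    finally show ?thesis
      using step[of "nat (a - 1)" "s - 1"] first Suc.prems triangular_add_1[of "s - 1"]
      by (simp add: algebra_simps)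
  next
    case last
    have "corner_sum s m 0 b =
        ?q ^ nat (- s) * corner_sum s (m - 1) 0 (b - 1) + corner_sum s m 1 b"
      using last m by (intro corner_sum_insert_last) auto
    also have "corner_sum s (m - 1) 0 (b - 1) =
        ?q ^ triangular s * path_weight level_weight t (nat (0 + (b - 1)))"
      using last Suc.prems by (intro Suc.IH) auto
    also have "corner_sum s m 1 b =
        ?q ^ triangular s * path_weight level_weight t (nat (1 + b))"
      using last Suc.prems by (intro Suc.IH) auto
    finally show ?thesis
      using step[of "nat (- s)" s] last Suc.prems by (simp add: algebra_simps)
  next
    case bottom
    \<comment> \<open>Inversion turns the bottom row into the first column, at the price of
      replacing \<open>s\<close> by \<open>1 - s\<close>.\<close>
    have "corner_sum (1 - s) m b a = ?q ^ nat (b - 1) * corner_sum (1 - s - 1) (m - 1) (b - 1) a +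
        corner_sum (1 - s) m (b + 1) a"
      using bottom Suc.prems m by (intro corner_sum_insert_first) auto
    then have "corner_sum s m a b =
        ?q ^ nat (b - 1) * corner_sum (s + 1) (m - 1) a (b - 1) + corner_sum s m a (b + 1)"
      using corner_sum_swap[of s m a b] corner_sum_swap[of "s + 1" "m - 1" a "b - 1"]
        corner_sum_swap[of s m a "b + 1"] by simp
    also have "corner_sum (s + 1) (m - 1) a (b - 1) =
        ?q ^ triangular (s + 1) * path_weight level_weight t (nat (a + (b - 1)))"
      using bottom Suc.prems by (intro Suc.IH) auto
    also have "corner_sum s m a (b + 1) =
        ?q ^ triangular s * path_weight level_weight t (nat (a + (b + 1)))"
      using bottom Suc.prems by (intro Suc.IH) auto
    finally show ?thesis
      using step[of "nat (b - 1)" "s + 1"] bottom Suc.prems triangular_add_1[of s]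
      by (simp add: algebra_simps)
  next
    case last'
    have "corner_sum (1 - s) m 0 a = ?q ^ nat (- (1 - s)) * corner_sum (1 - s) (m - 1) 0 (a - 1) +
        corner_sum (1 - s) m 1 a"
      using last' m by (intro corner_sum_insert_last) auto
    then have "corner_sum s m a 0 =
        ?q ^ nat (s - 1) * corner_sum s (m - 1) (a - 1) 0 + corner_sum s m a 1"
      using corner_sum_swap[of s m a 0] corner_sum_swap[of s "m - 1" "a - 1" 0]
        corner_sum_swap[of s m a 1] by simp
    also have "corner_sum s (m - 1) (a - 1) 0 =
        ?q ^ triangular s * path_weight level_weight t (nat (a - 1 + 0))"
      using last' Suc.prems by (intro Suc.IH) auto
    also have "corner_sum s m a 1 =
        ?q ^ triangular s * path_weight level_weight t (nat (a + 1))"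
      using last' Suc.prems by (intro Suc.IH) auto
    finally have "corner_sum s m a 0 =
        ?q ^ nat (s - 1) * (?q ^ triangular s * path_weight level_weight t (nat (a - 1))) +
        ?q ^ triangular s * path_weight level_weight t (nat (a + 1))"
      by simp
    moreover have "(a + b - 1) div 2 = s - 1" "0 \<le> s - 1" using last' by presburger+
    ultimately show ?thesis
      using step[of "nat (s - 1)" s] last' by simp
  next
    case origin
    have "corner_sum 0 m 0 0 = corner_sum 0 m 0 1"
      unfolding corner_sum_def corner_graphs_132_0_0[OF m] ..
    also have "\<dots> = ?q ^ triangular 0 * path_weight level_weight t (nat (0 + 1))"
      using origin Suc.prems by (intro Suc.IH) auto
    finally show ?thesis using origin by simp
  qed
qed

lemma sum_graphs_avoiding_132:
  "(\<Sum>G | G \<in> perm_graphs (int n) \<and> graph_avoids_132 G. [:0, 1:] ^ crossings 0 G) =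
    path_weight level_weight (2 * n) 0"
proof -
  have "corner_graphs_132 (int n) 0 0 = {G. G \<in> perm_graphs (int n) \<and> graph_avoids_132 G}"
    by (auto simp: corner_graphs_132_def)
  with corner_sum_eq_path_weight[of "2 * n" 0 0 "int n" 0] show ?thesis
    by (simp add: corner_sum_def triangular_def)
qed

section \<open>Avoiding 213 and the translation to one-line notation\<close>

definition graph_avoids_213 :: "(int \<times> int) set \<Rightarrow> bool" where
  "graph_avoids_213 G \<longleftrightarrow> (\<forall>x\<^sub>1 y\<^sub>1 x\<^sub>2 y\<^sub>2 x\<^sub>3 y\<^sub>3.
     (x\<^sub>1, y\<^sub>1) \<in> G \<longrightarrow> (x\<^sub>2, y\<^sub>2) \<in> G \<longrightarrow> (x\<^sub>3, y\<^sub>3) \<in> G \<longrightarrow>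
     x\<^sub>1 < x\<^sub>2 \<longrightarrow> x\<^sub>2 < x\<^sub>3 \<longrightarrow> y\<^sub>2 < y\<^sub>1 \<longrightarrow> y\<^sub>1 < y\<^sub>3 \<longrightarrow> False)"

text \<open>Reflection in the antidiagonal is the reverse-complement-inverse; it preserves crossings and
  exchanges the patterns 132 and 213.\<close>

definition antitranspose :: "int \<Rightarrow> int \<times> int \<Rightarrow> int \<times> int" where
  "antitranspose m p = (m + 1 - snd p, m + 1 - fst p)"

lemma antitranspose_antitranspose [simp]: "antitranspose m (antitranspose m p) = p"
  by (simp add: antitranspose_def)

lemma inj_antitranspose: "inj (antitranspose m)"
  by (rule injI) (metis antitranspose_antitranspose)

lemma mem_antitranspose_image:
  "(x, y) \<in> antitranspose m ` G \<longleftrightarrow> (m + 1 - y, m + 1 - x) \<in> G"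
proof
  assume "(m + 1 - y, m + 1 - x) \<in> G"
  from imageI[OF this, of "antitranspose m"] show "(x, y) \<in> antitranspose m ` G"
    by (simp add: antitranspose_def)
qed (auto simp: antitranspose_def)

lemma antitranspose_in_perm_graphs:
  assumes "G \<in> perm_graphs m"
  shows "antitranspose m ` G \<in> perm_graphs m"
proof -
  have inj: "bij_betw (antitranspose m) G (antitranspose m ` G)"
    by (rule inj_on_imp_bij_betw[OF inj_on_subset[OF inj_antitranspose subset_UNIV]])
  have flip: "bij_betw (\<lambda>x. m + 1 - x) {1..m} {1..m}"
    by (rule bij_betw_byWitness[where f' = "\<lambda>x. m + 1 - x"]) auto
  have "bij_betw (f \<circ> antitranspose m) G {1..m}"
    if "bij_betw g G {1..m}" "\<And>p. f (antitranspose m p) = m + 1 - g p" for f g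
    using bij_betw_trans[OF that(1) flip] that(2) by (simp add: comp_def)
  from this[of snd fst] this[of fst snd] assms show ?thesis
    by (simp add: perm_graphs_def antitranspose_def bij_betw_comp_iff[OF inj, symmetric])
qed

lemma antitranspose_avoids_213:
  assumes "graph_avoids_132 G"
  shows "graph_avoids_213 (antitranspose m ` G)"
  unfolding graph_avoids_213_def mem_antitranspose_image
proof (intro allI impI)
  fix x\<^sub>1 y\<^sub>1 x\<^sub>2 y\<^sub>2 x\<^sub>3 y\<^sub>3
  assume *: "(m + 1 - y\<^sub>1, m + 1 - x\<^sub>1) \<in> G" "(m + 1 - y\<^sub>2, m + 1 - x\<^sub>2) \<in> G" "(m + 1 - y\<^sub>3, m + 1 - x\<^sub>3) \<in> G"
    "x\<^sub>1 < x\<^sub>2" "x\<^sub>2 < x\<^sub>3" "y\<^sub>2 < y\<^sub>1" "y\<^sub>1 < y\<^sub>3"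
  then show False
    using graph_avoids_132D[OF assms *(3,1,2)] by simp
qed

lemma antitranspose_avoids_132:
  assumes "graph_avoids_213 G"
  shows "graph_avoids_132 (antitranspose m ` G)"
  unfolding graph_avoids_132_def mem_antitranspose_image
proof (intro allI impI)
  fix x\<^sub>1 y\<^sub>1 x\<^sub>2 y\<^sub>2 x\<^sub>3 y\<^sub>3
  assume *: "(m + 1 - y\<^sub>1, m + 1 - x\<^sub>1) \<in> G" "(m + 1 - y\<^sub>2, m + 1 - x\<^sub>2) \<in> G" "(m + 1 - y\<^sub>3, m + 1 - x\<^sub>3) \<in> G"
    "x\<^sub>1 < x\<^sub>2" "x\<^sub>2 < x\<^sub>3" "y\<^sub>1 < y\<^sub>3" "y\<^sub>3 < y\<^sub>2"
  then show False
    using assms[unfolded graph_avoids_213_def, rule_format, OF *(2,3,1)] by simp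
qed

text \<open>Unlike transposition, this reflection keeps each point on its side of the diagonal and
  reverses the order of a pair, so each kind of crossing is preserved with its own strict or weak
  inequality.\<close>

lemma crossings_antitranspose: "crossings 0 (antitranspose m ` G) = crossings 0 G"
proof -
  let ?f = "\<lambda>(p, r). (antitranspose m r, antitranspose m p)"
  have eq: "crosses 0 (antitranspose m r) (antitranspose m p) \<longleftrightarrow> crosses 0 p r" for p r
    by (cases p; cases r) (auto simp: antitranspose_def)
  have "bij_betw ?f {(p, r). p \<in> G \<and> r \<in> G \<and> crosses 0 p r}
      {(p, r). p \<in> antitranspose m ` G \<and> r \<in> antitranspose m ` G \<and> crosses 0 p r}"
    by (rule bij_betw_byWitness[where f' = ?f]) (auto simp: eq simp del: crosses.simps)
  then show ?thesis
    unfolding crossings_def by (rule bij_betw_same_card[symmetric])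
qed

lemma sum_graphs_avoiding_213:
  "(\<Sum>G | G \<in> perm_graphs (int n) \<and> graph_avoids_213 G. [:0, 1:] ^ crossings 0 G) =
    path_weight level_weight (2 * n) 0"
proof -
  let ?f = "image (antitranspose (int n))"
  have "(\<Sum>G | G \<in> perm_graphs (int n) \<and> graph_avoids_213 G. [:0, 1:] ^ crossings 0 G) =
      (\<Sum>G | G \<in> perm_graphs (int n) \<and> graph_avoids_132 G. ([:0, 1:] :: int poly) ^ crossings 0 G)"
    by (rule sum.reindex_bij_witness[where i = ?f and j = ?f])
      (simp_all add: antitranspose_in_perm_graphs antitranspose_avoids_213 antitranspose_avoids_132
        crossings_antitranspose image_image)
  then show ?thesis by (simp only: sum_graphs_avoiding_132)
qed

section \<open>Translation to one-line notation\<close>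

definition graph_of :: "nat list \<Rightarrow> (int \<times> int) set" where
  "graph_of \<sigma> = (\<lambda>i. (int i, int (perm_app \<sigma> i))) ` {1..length \<sigma>}"

lemma mem_graph_of:
  "(x, y) \<in> graph_of \<sigma> \<longleftrightarrow> (\<exists>i\<in>{1..length \<sigma>}. x = int i \<and> y = int (perm_app \<sigma> i))"
  by (auto simp: graph_of_def)

lemma perm_app_Suc: "perm_app \<sigma> (Suc i) = \<sigma> ! i"
  by (simp add: perm_app_def)

lemma inj_on_graph_of: "inj_on graph_of {\<sigma>. length \<sigma> = n}"
proof (rule inj_onI, simp, rule nth_equalityI)
  fix \<sigma> \<sigma>' :: "nat list" and i
  assume len: "length \<sigma> = n" "length \<sigma>' = n" and eq: "graph_of \<sigma> = graph_of \<sigma>'" and i: "i < length \<sigma>"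
  have "(int (Suc i), int (\<sigma> ! i)) \<in> graph_of \<sigma>"
    using i by (auto simp: mem_graph_of perm_app_Suc intro!: bexI[of _ "Suc i"])
  then have "(int (Suc i), int (\<sigma> ! i)) \<in> graph_of \<sigma>'" using eq by simp
  then obtain k where k: "int (Suc i) = int k" "int (\<sigma> ! i) = int (perm_app \<sigma>' k)"
    unfolding mem_graph_of by blast
  then have "k = Suc i" by linarith
  with k(2) show "\<sigma> ! i = \<sigma>' ! i" by (simp add: perm_app_Suc)
qed simp

lemma graph_of_in_perm_graphs:
  assumes "\<sigma> \<in> permutations_of_set {1..n}"
  shows "graph_of \<sigma> \<in> perm_graphs (int n)"
proof -
  have set: "set \<sigma> = {1..n}" and dist: "distinct \<sigma>"
    using assms by (auto simp: permutations_of_set_def)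
  have len: "length \<sigma> = n" using distinct_card[OF dist] set by simp
  let ?f = "\<lambda>i. (int i, int (perm_app \<sigma> i))"
  have inj: "inj_on ?f {1..n}" by (auto simp: inj_on_def)
  have "bij_betw int {1..n} {1..int n}"
    by (auto simp: bij_betw_def image_int_atLeastAtMost)
  moreover have "bij_betw (perm_app \<sigma>) {1..n} {1..n}"
  proof -
    have "{1..n} = Suc ` {..<n}" by (simp add: lessThan_atLeast0 image_Suc_atLeastLessThan atLeastLessThanSuc_atLeastAtMost)
    moreover have "bij_betw (perm_app \<sigma> \<circ> Suc) {..<n} {1..n}"
      using bij_betw_nth[OF dist, of "{..<n}" "{1..n}"] len set
      by (simp add: comp_def perm_app_Suc)
    ultimately show ?thesis
      using bij_betw_comp_iff[of Suc "{..<n}" "{1..n}" "perm_app \<sigma>" "{1..n}"]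
      by (simp add: bij_betw_def)
  qed
  ultimately have "bij_betw (int \<circ> perm_app \<sigma>) {1..n} {1..int n}" "bij_betw int {1..n} {1..int n}"
    by (auto intro: bij_betw_trans)
  then show ?thesis
    unfolding perm_graphs_def graph_of_def len mem_Collect_eq
      bij_betw_comp_iff[OF inj_on_imp_bij_betw[OF inj]]
    by (simp add: comp_def)
qed

lemma perm_graph_eq_graph_of:
  assumes G: "G \<in> perm_graphs (int n)"
  obtains \<sigma> where "\<sigma> \<in> permutations_of_set {1..n}" "graph_of \<sigma> = G"
proof -
  have "\<forall>i\<in>{1..n}. \<exists>y. (int i, int y) \<in> G"
  proof
    fix i assume "i \<in> {1..n}"
    then obtain y where y: "(int i, y) \<in> G" using perm_graphs_ex_snd[OF G, of "int i"] by auto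
    then have "(int i, int (nat y)) \<in> G" using perm_graphs_bounds[OF G y] by simp
    then show "\<exists>y. (int i, int y) \<in> G" ..
  qed
  then obtain f where f: "\<And>i. i \<in> {1..n} \<Longrightarrow> (int i, int (f i)) \<in> G" by metis
  define \<sigma> where "\<sigma> = map f [1..<Suc n]"
  have len: "length \<sigma> = n" by (simp add: \<sigma>_def)
  have app: "perm_app \<sigma> i = f i" if "i \<in> {1..n}" for i
    using that by (cases i) (simp_all add: perm_app_def \<sigma>_def del: upt_Suc)
  have "inj_on f {1..n}"
  proof (rule inj_onI)
    fix i j assume ij: "i \<in> {1..n}" "j \<in> {1..n}" "f i = f j"
    then have "int i = int j" using perm_graphs_unique_fst[OF G f[OF ij(1)]] f[OF ij(2)] by simp
    then show "i = j" by simp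
  qed
  then have "distinct \<sigma>" by (simp add: \<sigma>_def distinct_map atLeastLessThanSuc_atLeastAtMost del: upt_Suc)
  moreover have "f ` {1..n} = {1..n}"
  proof (rule card_subset_eq)
    show "f ` {1..n} \<subseteq> {1..n}" using perm_graphs_bounds(3,4)[OF G f] by force
    show "card (f ` {1..n}) = card {1..n}" using \<open>inj_on f {1..n}\<close> by (rule card_image)
  qed simp
  then have "set \<sigma> = {1..n}" by (simp add: \<sigma>_def atLeastLessThanSuc_atLeastAtMost del: upt_Suc)
  moreover have "graph_of \<sigma> = G"
  proof (intro equalityI subrelI)
    fix x y assume "(x, y) \<in> graph_of \<sigma>"
    then show "(x, y) \<in> G" using f app by (auto simp: mem_graph_of len)
  next
    fix x y assume xy: "(x, y) \<in> G"
    then have x: "nat x \<in> {1..n}" "int (nat x) = x" using perm_graphs_bounds[OF G xy] by auto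
    then have "y = int (f (nat x))" using perm_graphs_unique_snd[OF G xy] f[OF x(1)] by simp
    with x app show "(x, y) \<in> graph_of \<sigma>" by (auto simp: mem_graph_of len intro!: bexI[of _ "nat x"])
  qed
  ultimately show thesis using that by (simp add: permutations_of_set_def)
qed

lemma cr_eq_crossings: "cr \<sigma> = crossings 0 (graph_of \<sigma>)"
proof -
  let ?f = "\<lambda>i. (int i, int (perm_app \<sigma> i))"
  let ?A = "{(i, j). i \<in> {1..length \<sigma>} \<and> j \<in> {1..length \<sigma>} \<and>
     (i < j \<and> j < perm_app \<sigma> i \<and> perm_app \<sigma> i < perm_app \<sigma> j \<or>
      perm_app \<sigma> i < perm_app \<sigma> j \<and> perm_app \<sigma> j \<le> i \<and> i < j)}"
  have cross: "crosses 0 (?f i) (?f j) \<longleftrightarrow>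
      i < j \<and> j < perm_app \<sigma> i \<and> perm_app \<sigma> i < perm_app \<sigma> j \<or>
      perm_app \<sigma> i < perm_app \<sigma> j \<and> perm_app \<sigma> j \<le> i \<and> i < j" for i j
    by auto
  have "{(p, r). p \<in> graph_of \<sigma> \<and> r \<in> graph_of \<sigma> \<and> crosses 0 p r} = map_prod ?f ?f ` ?A"
    unfolding cross[symmetric] graph_of_def by (auto simp del: crosses.simps)
  moreover have "inj_on (map_prod ?f ?f) ?A" by (auto simp: inj_on_def)
  ultimately show ?thesis
    unfolding cr_def crossings_def by (simp only: card_image)
qed

text \<open>Two equivalences for each pair of positions, because the definition compares them in
  both orders; comparing a position with itself is trivial.\<close>

lemma contains_pattern_length_3:
  "contains_pattern \<sigma> [a, b, c] \<longleftrightarrow>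
    (\<exists>i j k. 1 \<le> i \<and> i < j \<and> j < k \<and> k \<le> length \<sigma> \<and>
      (perm_app \<sigma> i < perm_app \<sigma> j \<longleftrightarrow> a < b) \<and> (perm_app \<sigma> j < perm_app \<sigma> i \<longleftrightarrow> b < a) \<and>
      (perm_app \<sigma> i < perm_app \<sigma> k \<longleftrightarrow> a < c) \<and> (perm_app \<sigma> k < perm_app \<sigma> i \<longleftrightarrow> c < a) \<and>
      (perm_app \<sigma> j < perm_app \<sigma> k \<longleftrightarrow> b < c) \<and> (perm_app \<sigma> k < perm_app \<sigma> j \<longleftrightarrow> c < b))"
    (is "_ \<longleftrightarrow> (\<exists>i j k. ?occ i j k)")
proof -
  have set: "{1..length [a, b, c]} = {1, 2, 3}" by auto
  have app: "perm_app [a, b, c] 1 = a" "perm_app [a, b, c] 2 = b" "perm_app [a, b, c] 3 = c"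
    by (simp_all add: perm_app_def)
  show ?thesis
  proof
    assume "contains_pattern \<sigma> [a, b, c]"
    then obtain \<iota> where mono: "strict_mono_on {1, 2, 3} \<iota>" and im: "\<iota> ` {1, 2, 3} \<subseteq> {1..length \<sigma>}"
      and ord: "\<forall>x\<in>{1, 2, 3}. \<forall>y\<in>{1, 2, 3}.
        perm_app \<sigma> (\<iota> x) < perm_app \<sigma> (\<iota> y) \<longleftrightarrow> perm_app [a, b, c] x < perm_app [a, b, c] y"
      unfolding contains_pattern_def set by blast
    have "?occ (\<iota> 1) (\<iota> 2) (\<iota> 3)"
      using im ord[unfolded ball_simps app] strict_mono_onD[OF mono, of 1 2] strict_mono_onD[OF mono, of 2 3]
      by (simp add: app)
    then show "\<exists>i j k. ?occ i j k" by blast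
  next
    assume "\<exists>i j k. ?occ i j k"
    then obtain i j k where occ: "?occ i j k" by blast
    define \<iota> :: "nat \<Rightarrow> nat" where "\<iota> x = (if x = 1 then i else if x = 2 then j else k)" for x
    have \<iota>: "\<iota> 1 = i" "\<iota> 2 = j" "\<iota> 3 = k" by (simp_all add: \<iota>_def)
    have "strict_mono_on {1, 2, 3} \<iota>"
      using occ by (auto simp: strict_mono_on_def \<iota>_def)
    moreover have "\<iota> ` {1, 2, 3} \<subseteq> {1..length \<sigma>}"
      using occ by (auto simp: \<iota>_def)
    moreover have "\<forall>x\<in>{1, 2, 3}. \<forall>y\<in>{1, 2, 3}.
        perm_app \<sigma> (\<iota> x) < perm_app \<sigma> (\<iota> y) \<longleftrightarrow> perm_app [a, b, c] x < perm_app [a, b, c] y"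
      using occ by (simp only: ball_simps \<iota> app) simp
    ultimately show "contains_pattern \<sigma> [a, b, c]"
      unfolding contains_pattern_def set by blast
  qed
qed

text \<open>\<open>P\<close> is left open so that one translation serves the three patterns, whose
  occurrences differ only in the order of the values.\<close>

lemma ex_triple_in_graph_of:
  "(\<exists>x\<^sub>1 y\<^sub>1 x\<^sub>2 y\<^sub>2 x\<^sub>3 y\<^sub>3. (x\<^sub>1, y\<^sub>1) \<in> graph_of \<sigma> \<and> (x\<^sub>2, y\<^sub>2) \<in> graph_of \<sigma> \<and> (x\<^sub>3, y\<^sub>3) \<in> graph_of \<sigma> \<and>
      x\<^sub>1 < x\<^sub>2 \<and> x\<^sub>2 < x\<^sub>3 \<and> P y\<^sub>1 y\<^sub>2 y\<^sub>3) \<longleftrightarrow>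
    (\<exists>i j k. 1 \<le> i \<and> i < j \<and> j < k \<and> k \<le> length \<sigma> \<and>
      P (int (perm_app \<sigma> i)) (int (perm_app \<sigma> j)) (int (perm_app \<sigma> k)))"
  (is "?L \<longleftrightarrow> ?R")
proof
  assume ?L
  then obtain i j k where "i \<in> {1..length \<sigma>}" "j \<in> {1..length \<sigma>}" "k \<in> {1..length \<sigma>}"
    "int i < int j" "int j < int k"
    "P (int (perm_app \<sigma> i)) (int (perm_app \<sigma> j)) (int (perm_app \<sigma> k))"
    unfolding mem_graph_of by blast
  then show ?R by (intro exI[of _ i] exI[of _ j] exI[of _ k]) simp
next
  assume ?R
  then obtain i j k where ijk: "1 \<le> i" "i < j" "j < k" "k \<le> length \<sigma>"
    and P: "P (int (perm_app \<sigma> i)) (int (perm_app \<sigma> j)) (int (perm_app \<sigma> k))"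
    by blast
  have "(int l, int (perm_app \<sigma> l)) \<in> graph_of \<sigma>" if "l \<in> {i, j, k}" for l
    using that ijk unfolding graph_of_def by (intro imageI) auto
  moreover have "int i < int j" "int j < int k" using ijk by simp_all
  ultimately show ?L using P by blast
qed

lemma contains_pattern_iff_graph:
  "contains_pattern \<sigma> [3, 2, 1] \<longleftrightarrow> \<not> graph_avoids_321 (graph_of \<sigma>)"
  "contains_pattern \<sigma> [1, 3, 2] \<longleftrightarrow> \<not> graph_avoids_132 (graph_of \<sigma>)"
  "contains_pattern \<sigma> [2, 1, 3] \<longleftrightarrow> \<not> graph_avoids_213 (graph_of \<sigma>)"
proof -
  have "contains_pattern \<sigma> [3, 2, 1] \<longleftrightarrow> (\<exists>i j k. 1 \<le> i \<and> i < j \<and> j < k \<and> k \<le> length \<sigma> \<and>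
      int (perm_app \<sigma> i) > int (perm_app \<sigma> j) \<and> int (perm_app \<sigma> j) > int (perm_app \<sigma> k))"
    unfolding contains_pattern_length_3 by (intro ex_cong1) auto
  then show "contains_pattern \<sigma> [3, 2, 1] \<longleftrightarrow> \<not> graph_avoids_321 (graph_of \<sigma>)"
    unfolding graph_avoids_321_def ex_triple_in_graph_of[symmetric, where P = "\<lambda>y\<^sub>1 y\<^sub>2 y\<^sub>3. y\<^sub>1 > y\<^sub>2 \<and> y\<^sub>2 > y\<^sub>3"]
    by blast
  have "contains_pattern \<sigma> [1, 3, 2] \<longleftrightarrow> (\<exists>i j k. 1 \<le> i \<and> i < j \<and> j < k \<and> k \<le> length \<sigma> \<and>
      int (perm_app \<sigma> i) < int (perm_app \<sigma> k) \<and> int (perm_app \<sigma> k) < int (perm_app \<sigma> j))"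
    unfolding contains_pattern_length_3 by (intro ex_cong1) auto
  then show "contains_pattern \<sigma> [1, 3, 2] \<longleftrightarrow> \<not> graph_avoids_132 (graph_of \<sigma>)"
    unfolding graph_avoids_132_def ex_triple_in_graph_of[symmetric, where P = "\<lambda>y\<^sub>1 y\<^sub>2 y\<^sub>3. y\<^sub>1 < y\<^sub>3 \<and> y\<^sub>3 < y\<^sub>2"]
    by blast
  have "contains_pattern \<sigma> [2, 1, 3] \<longleftrightarrow> (\<exists>i j k. 1 \<le> i \<and> i < j \<and> j < k \<and> k \<le> length \<sigma> \<and>
      int (perm_app \<sigma> j) < int (perm_app \<sigma> i) \<and> int (perm_app \<sigma> i) < int (perm_app \<sigma> k))"
    unfolding contains_pattern_length_3 by (intro ex_cong1) auto
  then show "contains_pattern \<sigma> [2, 1, 3] \<longleftrightarrow> \<not> graph_avoids_213 (graph_of \<sigma>)"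
    unfolding graph_avoids_213_def ex_triple_in_graph_of[symmetric, where P = "\<lambda>y\<^sub>1 y\<^sub>2 y\<^sub>3. y\<^sub>2 < y\<^sub>1 \<and> y\<^sub>1 < y\<^sub>3"]
    by blast
qed

lemma sum_avoiders_of_size:
  assumes "\<tau> \<in> {[3, 2, 1], [1, 3, 2], [2, 1, 3]}"
  shows "(\<Sum>\<sigma>\<in>avoiders_of_size n \<tau>. [:0, 1:] ^ cr \<sigma>) = path_weight level_weight (2 * n) 0"
proof -
  have bij: "(\<Sum>\<sigma>\<in>avoiders_of_size n \<tau>. [:0, 1:] ^ cr \<sigma>) =
      (\<Sum>G | G \<in> perm_graphs (int n) \<and> av G. ([:0, 1:] :: int poly) ^ crossings 0 G)"
    if av: "\<And>\<sigma>. contains_pattern \<sigma> \<tau> \<longleftrightarrow> \<not> av (graph_of \<sigma>)" for av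
  proof -
    have "avoiders_of_size n \<tau> \<subseteq> {\<sigma>. length \<sigma> = n}"
      by (auto simp: avoiders_of_size_def dest: length_finite_permutations_of_set)
    then have "inj_on graph_of (avoiders_of_size n \<tau>)"
      by (rule inj_on_subset[OF inj_on_graph_of])
    moreover have "graph_of ` avoiders_of_size n \<tau> = {G. G \<in> perm_graphs (int n) \<and> av G}"
    proof (intro equalityI subsetI)
      fix G assume "G \<in> {G. G \<in> perm_graphs (int n) \<and> av G}"
      then have G: "G \<in> perm_graphs (int n)" "av G" by auto
      obtain \<sigma> where "\<sigma> \<in> permutations_of_set {1..n}" "graph_of \<sigma> = G"
        using perm_graph_eq_graph_of[OF G(1)] .
      with G av show "G \<in> graph_of ` avoiders_of_size n \<tau>" by (auto simp: avoiders_of_size_def)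
    qed (auto simp: avoiders_of_size_def av graph_of_in_perm_graphs)
    ultimately show ?thesis
      using sum.reindex[of graph_of "avoiders_of_size n \<tau>" "\<lambda>G. ([:0, 1:] :: int poly) ^ crossings 0 G"]
      by (simp only: cr_eq_crossings comp_def)
  qed
  from assms consider "\<tau> = [3, 2, 1]" | "\<tau> = [1, 3, 2]" | "\<tau> = [2, 1, 3]" by auto
  then show ?thesis
  proof cases
    case 1
    show ?thesis
      unfolding bij[OF contains_pattern_iff_graph(1)[folded 1]] by (rule sum_graphs_avoiding_321)
  next
    case 2
    show ?thesis
      unfolding bij[OF contains_pattern_iff_graph(2)[folded 2]] by (rule sum_graphs_avoiding_132)
  next
    case 3
    show ?thesis
      unfolding bij[OF contains_pattern_iff_graph(3)[folded 3]] by (rule sum_graphs_avoiding_213)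
  qed
qed

text \<open>Convergence of power series is coefficientwise: once a finite partial sum includes all
  objects of size \<open>n\<close>, its coefficient of \<open>fps_X ^ n\<close> no longer
  changes.\<close>

lemma has_sum_fps_by_size:
  fixes w :: "'b \<Rightarrow> 'a::comm_ring_1" and size :: "'b \<Rightarrow> nat"
  assumes "\<And>n. finite {x \<in> A. size x = n}"
  shows "((\<lambda>x. fps_const (w x) * fps_X ^ size x) has_sum Abs_fps (\<lambda>n. \<Sum>x | x \<in> A \<and> size x = n. w x)) A"
  unfolding has_sum_def
proof (rule tendsto_fpsI)
  fix n
  let ?X = "{x \<in> A. size x = n}"
  have "(\<Sum>x\<in>Y. fps_const (w x) * fps_X ^ size x) $ n = (\<Sum>x\<in>?X. w x)"
    if Y: "finite Y" "?X \<subseteq> Y" "Y \<subseteq> A" for Y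
  proof -
    have "(\<Sum>x\<in>Y. fps_const (w x) * fps_X ^ size x) $ n = (\<Sum>x\<in>Y. if size x = n then w x else 0)"
      by (simp add: fps_sum_nth eq_commute[of n] if_distrib cong: if_cong)
    also have "\<dots> = (\<Sum>x\<in>?X. w x)"
      using Y by (intro sum.mono_neutral_cong_right) auto
    finally show ?thesis .
  qed
  then show "\<forall>\<^sub>F Y in finite_subsets_at_top A.
      (\<Sum>x\<in>Y. fps_const (w x) * fps_X ^ size x) $ n = Abs_fps (\<lambda>n. \<Sum>x | x \<in> A \<and> size x = n. w x) $ n"
    unfolding eventually_finite_subsets_at_top using assms[of n]
    by (intro exI[of _ ?X]) auto
qed

theorem mainTheorem2:
  fixes \<tau> :: "nat list"
  assumes "\<tau> \<in> {[3, 2, 1], [1, 3, 2], [2, 1, 3]}"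
  shows "(\<forall>n. (\<Sum>\<sigma>\<in>avoiders_of_size n \<tau>. [:0, 1:] ^ cr \<sigma>) = poly (qp_catalan n) (1 :: int poly)) \<and>
    (\<lambda>\<sigma>. fps_const ([:0, 1:] ^ cr \<sigma> :: int poly) * fps_X ^ length \<sigma>) summable_on avoiders \<tau> \<and>
    (\<lambda>N. cfrac_convergent N (\<lambda>j. [:0, 1:] ^ (j div 2)))
      \<longlonglongrightarrow> (\<Sum>\<^sub>\<infinity>\<sigma>\<in>avoiders \<tau>. fps_const ([:0, 1:] ^ cr \<sigma> :: int poly) * fps_X ^ length \<sigma>)"
proof -
  obtain F :: "nat \<Rightarrow> int poly fps"
    where tails: "\<forall>h. F h = 1 + fps_const (level_weight h) * fps_X * F h * F (Suc h)"
      and F_0: "F 0 = Abs_fps q_catalan"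
    using ex_q_catalan_continued_fraction_tails by blast
  note F = spec[OF tails]
  have size: "(\<Sum>\<sigma>\<in>avoiders_of_size n \<tau>. [:0, 1:] ^ cr \<sigma>) = q_catalan n" for n
    using sum_avoiders_of_size[OF assms, of n] path_weight_continued_fraction[where F = F and c = level_weight and n = n, OF F]
    by (simp add: F_0)
  have length: "length \<sigma> = n" if "\<sigma> \<in> avoiders_of_size n \<tau>" for \<sigma> n
    using that length_finite_permutations_of_set[of \<sigma> "{1..n}"] by (simp add: avoiders_of_size_def)
  have by_size: "{\<sigma> \<in> avoiders \<tau>. length \<sigma> = n} = avoiders_of_size n \<tau>" for n
    using length by (auto simp: avoiders_def)
  have "finite (avoiders_of_size n \<tau>)" for n
    by (simp add: avoiders_of_size_def)
  then have "((\<lambda>\<sigma>. fps_const ([:0, 1:] ^ cr \<sigma> :: int poly) * fps_X ^ length \<sigma>) has_sum F 0) (avoiders \<tau>)"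
    using has_sum_fps_by_size[of "avoiders \<tau>" length "\<lambda>\<sigma>. [:0, 1:] ^ cr \<sigma> :: int poly"]
    by (simp add: by_size size F_0)
  then show ?thesis
    using size cfrac_convergent_tendsto[where F = F and c = level_weight, OF F] by (auto simp: infsumI dest: has_sum_imp_summable)
qed

end
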